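(* Let $h\ge2$ be even, $u\in(\mathbb Z/h\mathbb Z)^\times$, $n\ge0$, and $\xi_h:=e(1/h)$. Then $$L(-2n-1,b_{h,u})\in\mathbb Q(\xi_h),\qquad A_n(h,u)\in\mathbb Q(\xi_h).$$ If $v\in(\mathbb Z/h\mathbb Z)^\times$ and $\sigma_v$ is the automorphism of $\mathbb Q(\xi_h)$ with $\sigma_v(\xi_h)=\xi_h^v$, then $$\sigma_v\bigl(L(-2n-1,b_{h,u})\bigr)=L(-2n-1,b_{h,vu}),\qquad \sigma_v\bigl(A_n(h,u)\bigr)=A_n(h,vu).$$ Thus Galois conjugation $\sigma_v$ carries the radial value $\lim_{t\to0^+}W_n(-e(u/h)e^{-t})$ at $-e(u/h)$ to the radial value $\lim_{t\to0^+}W_n(-e(vu/h)e^{-t})$ at $-e(vu/h)$.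
   Context: Write $e(x)=e^{2\pi ix}$ and $T_k=k(k+1)/2$. For $h\ge2$ even and $u\in(\mathbb Z/h\mathbb Z)^\times$, the sequence $b_{h,u}:\mathbb Z\to\mathbb C$ is $b_{h,u}(2k+1):=e(uT_k/h)$, $b_{h,u}(2k):=0$ ($k\in\mathbb Z$); it is $4h$-periodic. For $\Re(s)>1$, $L(s,b_{h,u}):=\sum_{m\ge1}b_{h,u}(m)m^{-s}$, continued to $\mathbb C$ by $L(s,b_{h,u})=(4h)^{-s}\sum_{r=1}^{4h}b_{h,u}(r)\zeta(s,r/(4h))$ (Hurwitz zeta function). It is known that $L(-2n-1,b_{h,u})\neq0$ for all $n\ge0$, and $$A_n(h,u):=\frac{L(-2n-1,b_{h,u})}{L(-1,b_{h,u})}.$$ For $|q|<1$, $N_n(q):=\sum_{k\ge0}(-1)^{T_k}(2k+1)^{2n+1}q^{T_k}$ and $W_n(q):=N_n(q)/N_0(q)$ away from the zeros of $N_0$. The radial value of $W_n$ at the root of unity $\zeta=-e(u/h)$ is $\lim_{t\to0^+}W_n(\zeta e^{-t})$, which exists and equals $A_n(h,u)$. *)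

theory Defs
  imports
    "HOL-Complex_Analysis.Complex_Analysis"
    "HOL-Algebra.Generated_Fields"
    "HOL-Algebra.QuotRing"
    "HOL-Algebra.Algebraic_Closure_Type"
begin

definition ecis :: "real \<Rightarrow> complex" where
  "ecis x = exp (2 * of_real pi * \<i> * of_real x)"

text \<open>Polymorphic, so that it serves both the two-sided sequence (over \<^typ>\<open>int\<close>)
  and the one-sided power series (over \<^typ>\<open>nat\<close>).\<close>

definition tri :: "'a::semidom_modulo \<Rightarrow> 'a" where
  "tri k = k * (k + 1) div 2"

text \<open>Units of \<open>\<int>/h\<int>\<close> are represented by integers \<open>u\<close> coprime to \<open>h\<close>;
  the value depends only on the class of \<open>u\<close> (lemma \<open>bseq_cong\<close>).\<close>

definition bseq :: "nat \<Rightarrow> int \<Rightarrow> int \<Rightarrow> complex" where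
  "bseq h u m = (if odd m then ecis (of_int (u * tri (m div 2)) / of_nat h) else 0)"

lemma bseq_odd: "bseq h u (2 * k + 1) = ecis (of_int (u * tri k) / of_nat h)"
  and bseq_even: "bseq h u (2 * k) = 0"
  by (simp_all add: bseq_def)

lemma bseq_cong:
  assumes "h > 0" "u mod int h = u' mod int h"
  shows   "bseq h u m = bseq h u' m"
proof -
  obtain c where c: "u = u' + int h * c"
    using assms(2) by (metis mod_eqE add_diff_cancel_left' diff_add_cancel)
  have "ecis (of_int (u * k) / of_nat h) = ecis (of_int (u' * k) / of_nat h)" for k
  proof -
    have "of_int (u * k) / of_nat h = (of_int (u' * k) / of_nat h + of_int (c * k) :: real)"
      using assms(1) by (simp add: c field_simps)
    moreover have "exp (2 * complex_of_real pi * \<i> * of_int (c * k)) = 1"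
      by (subst exp_eq_1) (auto simp: algebra_simps intro!: exI[of _ "c * k"])
    ultimately show ?thesis
      by (simp only: ecis_def of_real_add distrib_left exp_add of_real_of_int_eq mult_1_right)
  qed
  thus ?thesis by (simp add: bseq_def)
qed

text \<open>The analytic continuation of \<open>\<Sum>k. (k + a) powr (-s)\<close>. Since \<open>\<complex> - {1}\<close> is
  connected, the conditions determine the function for all \<open>s \<noteq> 1\<close>; the value at
  the pole \<open>s = 1\<close> is unspecified.\<close>

definition hurwitz_zeta :: "real \<Rightarrow> complex \<Rightarrow> complex" where
  "hurwitz_zeta a = (SOME f. f holomorphic_on (- {1}) \<and>
     (\<forall>s. Re s > 1 \<longrightarrow> f s = (\<Sum>k::nat. of_real (real k + a) powr (- s))))"

definition L_b :: "nat \<Rightarrow> int \<Rightarrow> complex \<Rightarrow> complex" where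
  "L_b h u s = of_nat (4 * h) powr (- s) *
     (\<Sum>r = 1..4 * h. bseq h u (int r) * hurwitz_zeta (real r / real (4 * h)) s)"

definition A_ratio :: "nat \<Rightarrow> nat \<Rightarrow> int \<Rightarrow> complex" where
  "A_ratio n h u = L_b h u (- 2 * of_nat n - 1) / L_b h u (- 1)"

definition N_series :: "nat \<Rightarrow> complex \<Rightarrow> complex" where
  "N_series n q = (\<Sum>k::nat. (- 1) ^ tri k * of_nat (2 * k + 1) ^ (2 * n + 1) * q ^ tri k)"

definition W_ratio :: "nat \<Rightarrow> complex \<Rightarrow> complex" where
  "W_ratio n q = N_series n q / N_series 0 q"

definition radial_value :: "nat \<Rightarrow> complex \<Rightarrow> complex" where
  "radial_value n \<zeta> = Lim (at_right 0) (\<lambda>t::real. W_ratio n (\<zeta> * of_real (exp (- t))))"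

text \<open>\<open>\<rat>(\<xi>)\<close> for \<open>\<xi> = e(1/h)\<close>, as a subfield of \<open>\<complex>\<close>; a generated subfield contains the
  prime field \<open>\<rat>\<close> automatically.\<close>

definition cyclo_field :: "nat \<Rightarrow> complex set" where
  "cyclo_field h = generate_field ring_of_type_algebra {ecis (1 / of_nat h)}"

definition cyclo_aut :: "nat \<Rightarrow> (complex \<Rightarrow> complex) set" where
  "cyclo_aut h =
     (let K = ring_of_type_algebra\<lparr>carrier := cyclo_field h\<rparr> in ring_iso K K)"

end

theory Submission
  imports Defs
begin

text \<open>
  Write \<open>p = 2n + 1\<close>, \<open>y\<^sub>j = (2j + 1)/(2h)\<close> and \<open>\<beta>\<^sub>j = e(u T\<^sub>j/h)\<close>. Since \<open>h\<close> is even and \<open>u\<close> is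
  odd, the sequence \<open>b\<close> changes sign under the shift by \<open>2h\<close>, so its Dirichlet series is a
  combination, with coefficients \<open>(2h)^(-s) \<beta>\<^sub>j\<close> for \<open>j < h\<close>, of the alternating sums
  \<open>\<Sum>k. (-1)^k (k + y\<^sub>j)^(-s)\<close>. Such a sum continues to an entire function of \<open>s\<close>, whose value
  at \<open>s = -p\<close> is \<open>\<epsilon>\<^sub>p(y\<^sub>j)\<close>, where \<open>\<epsilon>\<^sub>p\<close> is one half of the \<open>p\<close>-th Euler polynomial. Hence
  \[ L(-p, b_{h,u}) = (2h)^p \sum_{j<h} \beta_j \epsilon_p(y_j), \]
  the number called \<open>theta_value p h u\<close> below. Here the weights \<open>\<epsilon>\<^sub>p(y\<^sub>j)\<close> are rational and
  \<open>\<beta>\<^sub>j\<close> is the power of \<open>\<xi> = e(1/h)\<close> with exponent \<open>u T\<^sub>j\<close>. So the value lies in \<open>\<rat>(\<xi>)\<close>, and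
  an automorphism with \<open>\<xi> \<mapsto> \<xi>^v\<close> replaces \<open>u\<close> by \<open>v u\<close> and changes nothing else; the same
  follows for quotients of such values.

  For the radial limit, \<open>8 T\<^sub>k + 1 = (2k + 1)\<^sup>2\<close> turns \<open>N_series n (-e(u/h) e^(-t))\<close> into the
  combination, with coefficients \<open>exp(t/8) (2h)^p \<beta>\<^sub>j\<close>, of the sums
  \<open>\<Sum>k. (-1)^k (k + y\<^sub>j)^p exp(-\<tau> (k + y\<^sub>j)\<^sup>2)\<close> with \<open>\<tau> = t h\<^sup>2/2\<close>. As \<open>\<tau>\<close> tends to \<open>0\<close> from above,
  each of them tends to \<open>\<epsilon>\<^sub>p(y\<^sub>j)\<close>, the same number that the continuation gives. So \<open>N_series n\<close>
  tends to \<open>L(-p, b)\<close>, and \<open>W_ratio n\<close> tends to \<open>A_ratio n h u\<close> once \<open>L(-1, b) \<noteq> 0\<close> is known.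

  Both evaluations of alternating sums, and the continuation of the Hurwitz zeta function on which
  the definition of \<open>L_b\<close> rests, come from one estimate (\<open>norm_step_defect_le\<close>): an
  Euler--Maclaurin type identity between values at \<open>z\<close> and at \<open>z + 1\<close> of a function and its
  derivatives fails only by a term bounded by a high derivative. Summed over \<open>z = k + y\<close>, the identity
  telescopes and the failure converges absolutely, locally uniformly in \<open>s\<close> or uniformly in \<open>\<tau>\<close>.

  Finally \<open>L(-1, b) \<noteq> 0\<close> (\<open>theta_value_1_nonzero\<close>): \<open>2 L(-1, b)\<close> is the pairing of \<open>\<beta>\<close> with the
  sawtooth \<open>2k + 1 - h\<close>. All relevant Fourier coefficients of \<open>\<beta>\<close> are Gauss sums of absolute value
  \<open>\<surd>h\<close>, while those of the sawtooth decay so fast that the lowest frequency (and its mirror image)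
  outweighs all others together.
\<close>

section \<open>Summation formulas over one unit step\<close>

text \<open>
  Read \<open>c\<close> as the differential operator \<open>c(D)\<close> and \<open>f\<close> as a tower of derivatives,
  \<open>f (j + 1) = (f j)'\<close>. By Taylor's formula the shift by \<open>1\<close> is \<open>exp(D)\<close>, so the two sums are
  truncations of the same object \<open>(c(D) exp(D) f)(z)\<close>. Their difference is the error committed by
  the summation formula with coefficients \<open>c\<close> on the step from \<open>z\<close> to \<open>z + 1\<close>.
\<close>

definition step_defect :: "complex fps \<Rightarrow> nat \<Rightarrow> (nat \<Rightarrow> complex \<Rightarrow> complex) \<Rightarrow> complex \<Rightarrow> complex" where
  "step_defect c N f z = (\<Sum>j\<le>N. fps_nth c j * f j (z + 1))
     - (\<Sum>m\<le>N. fps_nth (c * fps_exp 1) m * f m z)"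

text \<open>
  The coefficients of \<open>c * fps_exp 1\<close> are chosen so that expanding every \<open>f j (z + 1)\<close> to total
  order \<open>N\<close> cancels the second sum exactly. What is left are Taylor remainders, each bounded by the
  derivative of order \<open>N + 1\<close>.
\<close>

lemma norm_step_defect_le:
  assumes deriv: "\<And>i w. i \<le> N \<Longrightarrow> w \<in> closed_segment z (z + 1) \<Longrightarrow>
                    (f i has_field_derivative f (Suc i) w) (at w)"
    and bound: "\<And>w. w \<in> closed_segment z (z + 1) \<Longrightarrow> norm (f (Suc N) w) \<le> B"
  shows "norm (step_defect c N f z) \<le> (\<Sum>j\<le>N. norm (fps_nth c j)) * B"
proof -
  have B: "B \<ge> 0"
    using order_trans[OF norm_ge_zero bound[of z]] by simp
  have Taylor: "norm (f j (z + 1) - (\<Sum>i\<le>N - j. f (j + i) z / fact i)) \<le> B" if "j \<le> N" for j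
  proof -
    have "norm (f (j + 0) (z + 1) - (\<Sum>i\<le>N - j. f (j + i) z * (z + 1 - z) ^ i / fact i))
            \<le> B * norm (z + 1 - z) ^ Suc (N - j) / fact (N - j)"
    proof (rule field_Taylor[of "closed_segment z (z + 1)" "N - j" "\<lambda>i. f (j + i)"])
      fix i w assume "w \<in> closed_segment z (z + 1)" "i \<le> N - j"
      thus "(f (j + i) has_field_derivative f (j + Suc i) w) (at w within closed_segment z (z + 1))"
        using deriv[of "j + i" w] that by (auto intro: has_field_derivative_at_within)
    next
      fix w assume "w \<in> closed_segment z (z + 1)"
      thus "norm (f (j + Suc (N - j)) w) \<le> B"
        using bound that by simp
    qed auto
    also have "\<dots> \<le> B"
      using B mult_left_mono[of 1 "fact (N - j)" B] by (simp add: field_simps)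
    finally show ?thesis
      by simp
  qed
  have "(\<Sum>m\<le>N. fps_nth (c * fps_exp 1) m * f m z)
      = (\<Sum>m\<le>N. \<Sum>j\<le>m. fps_nth c j * (f (j + (m - j)) z / fact (m - j)))"
    by (auto simp: fps_mult_nth sum_distrib_right atMost_atLeast0 intro!: sum.cong)
  also have "\<dots> = (\<Sum>(j, i)\<in>{(j, i). j + i \<le> N}. fps_nth c j * (f (j + i) z / fact i))"
    by (rule sum.triangle_reindex_eq[symmetric])
  also have "{(j, i). j + i \<le> N} = (SIGMA j:{..N}. {..N - j})"
    by auto
  also have "(\<Sum>(j, i)\<in>\<dots>. fps_nth c j * (f (j + i) z / fact i))
      = (\<Sum>j\<le>N. fps_nth c j * (\<Sum>i\<le>N - j. f (j + i) z / fact i))"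
    by (simp add: sum.Sigma[symmetric] sum_distrib_left)
  finally have "step_defect c N f z
      = (\<Sum>j\<le>N. fps_nth c j * (f j (z + 1) - (\<Sum>i\<le>N - j. f (j + i) z / fact i)))"
    by (simp add: step_defect_def sum_subtractf right_diff_distrib)
  also have "norm \<dots> \<le> (\<Sum>j\<le>N. norm (fps_nth c j) * B)"
    by (intro sum_norm_le) (auto simp: norm_mult intro!: mult_left_mono Taylor)
  finally show ?thesis
    by (simp add: sum_distrib_right)
qed

text \<open>
  The generating function \<open>1/(1 + e^x)\<close> of one half of the values at \<open>0\<close> of the Euler polynomials,
  divided by factorials. With \<open>E = exp(D)\<close> the shift, \<open>(1 + E) c(D) = 1\<close> makes it the right
  choice for alternating sums (Boole summation).
\<close>

definition euler_coeffs :: "complex fps" where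
  "euler_coeffs = inverse (1 + fps_exp 1)"

lemma euler_coeffs_times_exp: "euler_coeffs * fps_exp 1 = 1 - euler_coeffs"
proof -
  have "euler_coeffs * (1 + fps_exp 1) = 1"
    unfolding euler_coeffs_def by (rule inverse_mult_eq_1) simp
  thus ?thesis
    by (simp add: algebra_simps eq_diff_eq)
qed

text \<open>
  For these coefficients the defect compares \<open>f 0 z\<close> with \<open>F(z) + F(z + 1)\<close>, where
  \<open>F = c(D) f\<close>; along \<open>z = k + y\<close> and with signs \<open>(-1)^k\<close> the latter telescopes to \<open>F(y)\<close>.
\<close>

lemma step_defect_euler_coeffs:
  "step_defect euler_coeffs N f z
     = (\<Sum>j\<le>N. fps_nth euler_coeffs j * f j (z + 1)) + (\<Sum>j\<le>N. fps_nth euler_coeffs j * f j z)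
       - f 0 z"
proof -
  have "(\<Sum>m\<le>N. fps_nth (1 - euler_coeffs) m * f m z)
      = (\<Sum>m\<le>N. (if m = 0 then f m z else 0)) - (\<Sum>m\<le>N. fps_nth euler_coeffs m * f m z)"
    unfolding sum_subtractf[symmetric] by (intro sum.cong) (auto simp: algebra_simps)
  thus ?thesis
    by (simp add: step_defect_def euler_coeffs_times_exp)
qed

lemma euler_coeffs_rec:
  "2 * fps_nth euler_coeffs m = (if m = 0 then 1 else 0) - (\<Sum>j<m. fps_nth euler_coeffs j / fact (m - j))"
proof -
  have "fps_nth (euler_coeffs * fps_exp 1) m
      = (\<Sum>j<m. fps_nth euler_coeffs j / fact (m - j)) + fps_nth euler_coeffs m"
    by (simp add: fps_mult_nth atMost_atLeast0[symmetric] lessThan_Suc_atMost[symmetric])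
  thus ?thesis
    by (simp add: euler_coeffs_times_exp algebra_simps eq_diff_eq)
qed

lemma euler_coeffs_rat: "fps_nth euler_coeffs m \<in> \<rat>"
proof (induction m rule: less_induct)
  case (less m)
  have "fact k \<in> (\<rat> :: complex set)" for k
    by (metis of_nat_fact Rats_of_nat)
  hence "(if m = 0 then 1 else 0) - (\<Sum>j<m. fps_nth euler_coeffs j / fact (m - j)) \<in> \<rat>"
    by (intro Rats_diff Rats_sum Rats_divide less.IH) auto
  hence "2 * fps_nth euler_coeffs m / 2 \<in> \<rat>"
    unfolding euler_coeffs_rec by (intro Rats_divide) auto
  thus ?case
    by simp
qed

text \<open>
  The generating function \<open>x/(e^x - 1)\<close> of the Bernoulli numbers divided by factorials; the shift by
  one index turns \<open>exp\<close> into \<open>(e^x - 1)/x\<close>, which has a nonzero constant term.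
\<close>

definition bernoulli_coeffs :: "complex fps" where
  "bernoulli_coeffs = inverse (fps_shift 1 (fps_exp 1))"

lemma bernoulli_coeffs_times_exp:
  "bernoulli_coeffs * fps_exp 1 = bernoulli_coeffs + fps_X"
proof -
  have "(fps_exp 1 :: complex fps) = 1 + fps_X * fps_shift 1 (fps_exp 1)"
    by (rule fps_ext) (simp add: fps_X_mult_nth)
  moreover have "bernoulli_coeffs * fps_shift 1 (fps_exp 1) = 1"
    unfolding bernoulli_coeffs_def by (rule inverse_mult_eq_1) simp
  ultimately have "bernoulli_coeffs * fps_exp 1
      = bernoulli_coeffs + fps_X * (bernoulli_coeffs * fps_shift 1 (fps_exp 1))"
    by (metis distrib_left mult.left_commute mult.right_neutral)
  thus ?thesis
    using \<open>bernoulli_coeffs * fps_shift 1 (fps_exp 1) = 1\<close> by simp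
qed

text \<open>
  Here the defect compares \<open>f 1 z\<close> with \<open>F(z + 1) - F(z)\<close>, where \<open>F = c(D) f\<close>: the
  Euler--Maclaurin formula for \<open>\<Sum> f'\<close>.
\<close>

lemma step_defect_bernoulli_coeffs:
  assumes "N \<ge> 1"
  shows "step_defect bernoulli_coeffs N f z
     = (\<Sum>j\<le>N. fps_nth bernoulli_coeffs j * f j (z + 1))
       - (\<Sum>j\<le>N. fps_nth bernoulli_coeffs j * f j z) - f 1 z"
proof -
  have "(\<Sum>m\<le>N. fps_nth (bernoulli_coeffs + fps_X) m * f m z)
      = (\<Sum>m\<le>N. fps_nth bernoulli_coeffs m * f m z) + (\<Sum>m\<le>N. (if m = 1 then f m z else 0))"
    unfolding sum.distrib[symmetric] by (intro sum.cong) (auto simp: algebra_simps fps_X_def)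
  thus ?thesis
    using assms by (simp add: step_defect_def bernoulli_coeffs_times_exp)
qed

text \<open>The \<open>j\<close>-th derivative of \<open>z \<mapsto> z powr (-s)\<close>, written out so that it is visibly entire in \<open>s\<close>.\<close>

definition powr_tower :: "complex \<Rightarrow> nat \<Rightarrow> complex \<Rightarrow> complex" where
  "powr_tower s j z = (\<Prod>i<j. - s - of_nat i) * z powr (- s - of_nat j)"

lemma has_field_derivative_powr_tower:
  assumes "z \<notin> \<real>\<^sub>\<le>\<^sub>0"
  shows "(powr_tower s j has_field_derivative powr_tower s (Suc j) z) (at z)"
proof -
  have "((\<lambda>z. (\<Prod>i<j. - s - of_nat i) * z powr (- s - of_nat j)) has_field_derivative
      (\<Prod>i<j. - s - of_nat i) * ((- s - of_nat j) * z powr (- s - of_nat j - 1))) (at z)"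
    by (intro DERIV_cmult has_field_derivative_powr assms)
  thus ?thesis
    unfolding powr_tower_def by (simp add: algebra_simps)
qed

lemma norm_powr_tower:
  assumes "x > 0"
  shows "norm (powr_tower s j (of_real x)) = (\<Prod>i<j. norm (s + of_nat i)) * x powr (- Re s - of_nat j)"
proof -
  have "norm (- s - of_nat i) = norm (s + of_nat i)" for i
    by (metis add_uminus_conv_diff minus_add_distrib norm_minus_cancel)
  moreover have "norm (of_real x powr (- s - of_nat j)) = x powr (- Re s - of_nat j)"
    using assms by (subst norm_powr_real_powr) auto
  ultimately show ?thesis
    by (simp add: powr_tower_def norm_mult prod_norm[symmetric])
qed

lemma of_real_in_unit_segment:
  assumes "w \<in> closed_segment (of_real x) (of_real x + 1)"
  obtains t where "w = of_real t" "x \<le> t" "t \<le> x + (1::real)"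
proof -
  have "closed_segment (of_real x :: 'a) (of_real x + 1) = closed_segment (of_real x) (of_real (x + 1))"
    by simp
  with assms have "w \<in> of_real ` closed_segment x (x + 1)"
    by (metis closed_segment_of_real)
  thus ?thesis
    using that by (auto simp: closed_segment_eq_real_ivl)
qed

lemma norm_step_defect_powr_tower_le:
  assumes "x > 0" "Re s + of_nat N + 1 \<ge> 0"
  shows "norm (step_defect c N (powr_tower s) (of_real x)) \<le>
    (\<Sum>j\<le>N. norm (fps_nth c j)) *
    ((\<Prod>i<Suc N. norm (s + of_nat i)) * x powr (- Re s - of_nat N - 1))"
proof (rule norm_step_defect_le)
  fix i w assume "w \<in> closed_segment (complex_of_real x) (of_real x + 1)"
  then obtain t where "w = of_real t" "x \<le> t"
    by (elim of_real_in_unit_segment)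
  with assms show "(powr_tower s i has_field_derivative powr_tower s (Suc i) w) (at w)"
    by (intro has_field_derivative_powr_tower) auto
next
  fix w assume "w \<in> closed_segment (complex_of_real x) (of_real x + 1)"
  then obtain t where t: "w = of_real t" "x \<le> t"
    by (elim of_real_in_unit_segment)
  have "norm (powr_tower s (Suc N) w) = (\<Prod>i<Suc N. norm (s + of_nat i)) * t powr (- Re s - of_nat (Suc N))"
    unfolding t(1) using t(2) assms by (intro norm_powr_tower) auto
  also have "\<dots> \<le> (\<Prod>i<Suc N. norm (s + of_nat i)) * x powr (- Re s - of_nat (Suc N))"
    using t assms by (intro mult_left_mono powr_mono2' prod_nonneg) auto
  also have "- Re s - of_nat (Suc N) = - Re s - of_nat N - 1"
    by simp
  finally show "norm (powr_tower s (Suc N) w) \<le>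
      (\<Prod>i<Suc N. norm (s + of_nat i)) * x powr (- Re s - of_nat N - 1)" .
qed

lemma step_defect_powr_tower_holomorphic:
  shows "(\<lambda>s. step_defect c N (powr_tower s) z) holomorphic_on A"
proof -
  have "(\<lambda>s. z powr (- s - of_nat j)) holomorphic_on A" for z j
    by (intro holomorphic_on_powr_right holomorphic_intros)
  thus ?thesis
    unfolding step_defect_def powr_tower_def by (intro holomorphic_intros)
qed

text \<open>
  The defect of \<open>z powr (-s)\<close> of order \<open>N\<close> at \<open>k + y\<close> is \<open>O(k powr (- Re s - N - 1))\<close>, locally
  uniformly in \<open>s\<close>. So the sum of the defects, with arbitrary bounded weights, is holomorphic in a
  half-plane that grows with \<open>N\<close>. This is where the analytic continuations come from.
\<close>

lemma step_defect_powr_tower_sum: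
  fixes sg :: "nat \<Rightarrow> complex"
  assumes y: "y > 0" and sg: "\<And>k. norm (sg k) \<le> 1"
  shows step_defect_powr_tower_summable:
      "Re s > - of_nat N \<Longrightarrow> summable (\<lambda>k. sg k * step_defect c N (powr_tower s) (of_real (of_nat k + y)))"
    and step_defect_powr_tower_sum_holomorphic:
      "(\<lambda>s. \<Sum>k. sg k * step_defect c N (powr_tower s) (of_real (of_nat k + y))) holomorphic_on {s. Re s > - of_nat N}"
proof -
  define E where "E = (\<lambda>k s. sg k * step_defect c N (powr_tower s) (of_real (of_nat k + y)))"
  have bound: "\<exists>d>0. cball s d \<subseteq> {s. Re s > - of_nat N} \<and>
      (\<exists>M. summable M \<and> (\<forall>\<^sub>F k in sequentially. \<forall>t\<in>cball s d. norm (E k t) \<le> M k))"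
    if s: "Re s > - of_nat N" for s
  proof -
    (* Half the distance to the boundary line, so that Re t >= \<sigma> > -N on the closed ball. *)
    define d where "d = (Re s + of_nat N) / 2"
    define \<sigma> where "\<sigma> = Re s - d"
    define C where "C = (\<Sum>j\<le>N. norm (fps_nth c j)) * (norm s + d + of_nat N) ^ Suc N"
    have d: "d > 0" and \<sigma>: "\<sigma> > - of_nat N"
      using s by (auto simp: d_def \<sigma>_def field_simps)
    have t: "Re t \<ge> \<sigma>" "norm (t + of_nat i) \<le> norm s + d + of_nat N"
      if "t \<in> cball s d" "i < Suc N" for t i
    proof -
      have *: "norm (t - s) \<le> d"
        using that by (simp add: dist_norm norm_minus_commute)
      thus "Re t \<ge> \<sigma>"
        using abs_Re_le_cmod[of "t - s"] by (simp add: \<sigma>_def)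
      have "norm (t + of_nat i) = norm (s + (t - s) + of_nat i)"
        by simp
      also have "\<dots> \<le> norm s + norm (t - s) + norm (of_nat i :: complex)"
        by (meson norm_triangle_ineq norm_triangle_le add_mono order_refl order_trans)
      also have "\<dots> \<le> norm s + d + of_nat N"
        using * that(2) by (simp add: add_mono)
      finally show "norm (t + of_nat i) \<le> norm s + d + of_nat N" .
    qed
    have "norm (E k r) \<le> C * of_nat k powr (- \<sigma> - of_nat N - 1)" if k: "k \<ge> 1" and r: "r \<in> cball s d" for k r
    proof -
      have "norm (E k r) \<le> norm (step_defect c N (powr_tower r) (of_real (of_nat k + y)))"
        using mult_right_mono[OF sg[of k] norm_ge_zero] unfolding E_def norm_mult by simp
      also have "\<dots> \<le> (\<Sum>j\<le>N. norm (fps_nth c j)) *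
          ((\<Prod>i<Suc N. norm (r + of_nat i)) * (of_nat k + y) powr (- Re r - of_nat N - 1))"
        using t(1)[OF r, of 0] \<sigma> y k by (intro norm_step_defect_powr_tower_le) auto
      also have "\<dots> \<le> (\<Sum>j\<le>N. norm (fps_nth c j)) *
          ((norm s + d + of_nat N) ^ Suc N * of_nat k powr (- \<sigma> - of_nat N - 1))"
      proof (intro mult_left_mono mult_mono)
        have "(\<Prod>i<Suc N. norm (r + of_nat i)) \<le> (\<Prod>i<Suc N. norm s + d + of_nat N)"
          using t(2)[OF r] by (intro prod_mono) auto
        thus "(\<Prod>i<Suc N. norm (r + of_nat i)) \<le> (norm s + d + of_nat N) ^ Suc N"
          by simp
        have "(of_nat k + y) powr (- Re r - of_nat N - 1) \<le> of_nat k powr (- Re r - of_nat N - 1)"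
          using t(1)[OF r, of 0] \<sigma> y k by (intro powr_mono2') auto
        also have "\<dots> \<le> of_nat k powr (- \<sigma> - of_nat N - 1)"
          using t(1)[OF r, of 0] k by (intro powr_mono) auto
        finally show "(of_nat k + y) powr (- Re r - of_nat N - 1) \<le> of_nat k powr (- \<sigma> - of_nat N - 1)" .
      qed (use d in \<open>auto intro!: sum_nonneg prod_nonneg\<close>)
      finally show ?thesis
        by (simp add: C_def mult.assoc)
    qed
    hence "\<forall>\<^sub>F k in sequentially. \<forall>t\<in>cball s d. norm (E k t) \<le> C * of_nat k powr (- \<sigma> - of_nat N - 1)"
      by (intro eventually_mono[OF eventually_ge_at_top[of 1]]) auto
    moreover have "summable (\<lambda>k. C * of_nat k powr (- \<sigma> - of_nat N - 1))"
      using \<sigma> by (intro summable_mult) (simp add: summable_real_powr_iff)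
    moreover have "cball s d \<subseteq> {s. Re s > - of_nat N}"
      using t(1)[of _ 0] \<sigma> by fastforce
    ultimately show ?thesis
      using d by (intro exI[of _ d] conjI exI[of _ "\<lambda>k. C * of_nat k powr (- \<sigma> - of_nat N - 1)"])
  qed
  show "summable (\<lambda>k. sg k * step_defect c N (powr_tower s) (of_real (of_nat k + y)))" if "Re s > - of_nat N"
  proof -
    from bound[OF that] obtain d M where "d > 0" "summable M"
      "\<forall>\<^sub>F k in sequentially. \<forall>t\<in>cball s d. norm (E k t) \<le> M k" by (elim exE conjE)
    hence "\<forall>\<^sub>F k in sequentially. norm (E k s) \<le> M k"
      by (auto elim!: eventually_mono)
    thus ?thesis
      using \<open>summable M\<close> unfolding E_def by (rule summable_comparison_test_ev)
  qed
  show "(\<lambda>s. \<Sum>k. sg k * step_defect c N (powr_tower s) (of_real (of_nat k + y))) holomorphic_on {s. Re s > - of_nat N}"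
  proof (rule holomorphic_uniform_sequence)
    show "open {s. Re s > - of_nat N}"
      by (rule open_halfspace_Re_gt)
    show "(\<lambda>s. \<Sum>k<n. E k s) holomorphic_on {s. Re s > - of_nat N}" for n
      unfolding E_def using y by (intro holomorphic_intros step_defect_powr_tower_holomorphic)
    fix s :: complex assume "s \<in> {s. Re s > - of_nat N}"
    hence "Re s > - of_nat N" by simp
    from bound[OF this] obtain d M where dM: "d > 0" "cball s d \<subseteq> {s. Re s > - of_nat N}" "summable M"
      "\<forall>\<^sub>F k in sequentially. \<forall>t\<in>cball s d. norm (E k t) \<le> M k" by (elim exE conjE)
    have "uniform_limit (cball s d) (\<lambda>n s. \<Sum>k<n. E k s) (\<lambda>s. \<Sum>k. E k s) sequentially"
      by (rule Weierstrass_m_test_ev) (use dM in auto)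
    thus "\<exists>d>0. cball s d \<subseteq> {s. Re s > - of_nat N} \<and>
        uniform_limit (cball s d) (\<lambda>n s. \<Sum>k<n. E k s)
          (\<lambda>s. \<Sum>k. sg k * step_defect c N (powr_tower s) (of_real (of_nat k + y))) sequentially"
      using dM(1,2) unfolding E_def by (intro exI[of _ d] conjI)
  qed
qed

section \<open>The Hurwitz zeta function and its alternating analogue\<close>

lemma add_const_at_top: "filterlim (\<lambda>k. of_nat k + y :: real) at_top sequentially"
  using filterlim_tendsto_add_at_top[OF tendsto_const filterlim_real_sequentially, of y]
  by (simp add: add.commute)

lemma powr_tower_tendsto_0:
  assumes "Re s > 0" "y > 0"
  shows "(\<lambda>k. powr_tower s j (of_real (of_nat k + y))) \<longlonglongrightarrow> 0"
proof (rule tendsto_norm_zero_cancel)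
  have "(\<lambda>k. (\<Prod>i<j. norm (s + of_nat i)) * (of_nat k + y) powr (- Re s - of_nat j)) \<longlonglongrightarrow>
          (\<Prod>i<j. norm (s + of_nat i)) * 0"
  proof (intro tendsto_mult tendsto_const)
    show "(\<lambda>k. (of_nat k + y) powr (- Re s - of_nat j)) \<longlonglongrightarrow> 0"
      using assms by (intro tendsto_neg_powr add_const_at_top) auto
  qed
  thus "(\<lambda>k. norm (powr_tower s j (of_real (of_nat k + y)))) \<longlonglongrightarrow> 0"
    using assms by (simp add: norm_powr_tower del: of_real_add)
qed

lemma powr_tower_0 [simp]: "powr_tower s 0 z = z powr (- s)"
  by (simp add: powr_tower_def)

lemma holomorphic_on_powr_tower: "(\<lambda>s. powr_tower (g s) j z) holomorphic_on A" if "g holomorphic_on A"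
  unfolding powr_tower_def by (intro holomorphic_intros holomorphic_on_powr_right that)

text \<open>
  Euler--Maclaurin summation is applied to the derivatives of \<open>z powr (1 - s)\<close>, whose first
  derivative is \<open>(1 - s) z powr (-s)\<close>. Starting one step before the summand avoids the division
  by \<open>1 - s\<close>, so that \<open>Z\<close> has no pole and continues \<open>(1 - s) \<zeta>(s, a)\<close>.
\<close>

lemma hurwitz_continuation_strip:
  assumes a: "a > 0" and N: "N \<ge> 1"
  defines "F \<equiv> \<lambda>s z. \<Sum>j\<le>N. fps_nth bernoulli_coeffs j * powr_tower (s - 1) j z"
  defines "Z \<equiv> \<lambda>s. - F s (of_real a)
    - (\<Sum>k. step_defect bernoulli_coeffs N (powr_tower (s - 1)) (of_real (of_nat k + a)))"
  shows "Z holomorphic_on {s. Re s > 1 - of_nat N}"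
    and "Re s > 1 \<Longrightarrow> (\<lambda>k. (1 - s) * of_real (of_nat k + a) powr (- s)) sums Z s"
proof -
  define E where "E = (\<lambda>s k. step_defect bernoulli_coeffs N (powr_tower s) (of_real (of_nat k + a)))"
  have hol: "(\<lambda>s. \<Sum>k. E s k) holomorphic_on {s. Re s > - of_nat N}"
    using step_defect_powr_tower_sum_holomorphic[OF a, of "\<lambda>_. 1" bernoulli_coeffs N] by (simp add: E_def)
  have "((\<lambda>s. \<Sum>k. E s k) \<circ> (\<lambda>s. s - 1)) holomorphic_on {s. Re s > 1 - of_nat N}"
    by (rule holomorphic_on_compose_gen[OF _ hol]) (auto intro!: holomorphic_intros)
  thus "Z holomorphic_on {s. Re s > 1 - of_nat N}"
    unfolding Z_def F_def E_def o_def by (intro holomorphic_intros holomorphic_on_powr_tower)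
  show "(\<lambda>k. (1 - s) * of_real (of_nat k + a) powr (- s)) sums Z s" if s: "Re s > 1"
  proof -
    have "(\<lambda>k. F s (of_real (of_nat k + a))) \<longlonglongrightarrow> (\<Sum>j\<le>N. fps_nth bernoulli_coeffs j * 0)"
      unfolding F_def using s a by (intro tendsto_intros powr_tower_tendsto_0) auto
    hence "(\<lambda>k. F s (of_real (of_nat (Suc k) + a)) - F s (of_real (of_nat k + a))) sums
             (0 - F s (of_real (of_nat 0 + a)))"
      by (intro telescope_sums) simp
    moreover have "(\<lambda>k. E (s - 1) k) sums (\<Sum>k. E (s - 1) k)"
      using step_defect_powr_tower_summable[OF a, of "\<lambda>_. 1" N "s - 1"] s by (intro summable_sums) (simp add: E_def)
    ultimately have "(\<lambda>k. F s (of_real (of_nat (Suc k) + a)) - F s (of_real (of_nat k + a)) - E (s - 1) k)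
        sums (0 - F s (of_real (of_nat 0 + a)) - (\<Sum>k. E (s - 1) k))"
      by (rule sums_diff)
    moreover have "F s (of_real (of_nat (Suc k) + a)) - F s (of_real (of_nat k + a)) - E (s - 1) k
        = (1 - s) * of_real (of_nat k + a) powr (- s)" for k
      using N by (simp add: E_def F_def step_defect_bernoulli_coeffs powr_tower_def add_ac)
        (simp add: algebra_simps)
    ultimately show ?thesis
      by (simp add: Z_def E_def)
  qed
qed

text \<open>
  Continuations to growing half-planes of one function agree with each other by the identity theorem,
  hence they are restrictions of a single entire function.
\<close>

lemma holomorphic_glue_halfplanes:
  fixes Z :: "nat \<Rightarrow> complex \<Rightarrow> complex" and g :: "complex \<Rightarrow> complex"
  assumes hol: "\<And>N. N \<ge> 1 \<Longrightarrow> Z N holomorphic_on {s. Re s > 1 - of_nat N}"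
    and eq: "\<And>N s. N \<ge> 1 \<Longrightarrow> Re s > 1 \<Longrightarrow> Z N s = g s"
  shows "\<exists>f. f holomorphic_on UNIV \<and> (\<forall>s. Re s > 1 \<longrightarrow> f s = g s)"
proof -
  (* Any index N with Re s > 1 - N would do; this one works for every s. *)
  define f where "f = (\<lambda>s. Z (nat \<lceil>\<bar>Re s\<bar>\<rceil> + 2) s)"
  have same: "Z M s = Z N s" if "M \<ge> 1" "N \<ge> M" "Re s > 1 - of_nat M" for M N s
  proof (rule analytic_continuation_open[of "{s. Re s > 1}" "{s. Re s > 1 - of_nat M}" "Z M" "Z N"])
    show "connected {s. Re s > 1 - of_nat M}"
      by (intro convex_connected convex_halfspace_Re_gt)
    have "Re 2 > 1" by simp
    thus "{s. Re s > 1} \<noteq> {}" by blast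
    show "Z N holomorphic_on {s. Re s > 1 - of_nat M}"
      by (rule holomorphic_on_subset[OF hol]) (use that in auto)
  qed (use that eq hol open_halfspace_Re_gt in auto)
  have f_eq: "f s = Z N s" if "N \<ge> 1" "Re s > 1 - of_nat N" for N s
  proof -
    define M where "M = nat \<lceil>\<bar>Re s\<bar>\<rceil> + 2"
    have M: "M \<ge> 1" "Re s > 1 - of_nat M"
      unfolding M_def by linarith+
    have "Z M s = Z N s"
    proof (cases "M \<le> N")
      case True
      thus ?thesis
        by (intro same M)
    next
      case False
      thus ?thesis
        by (intro same[symmetric] that) simp
    qed
    thus ?thesis
      by (simp add: f_def M_def)
  qed
  have "f holomorphic_on (\<Union>N\<in>{1..}. {s. Re s > 1 - of_nat N})"
  proof (rule holomorphic_on_UN_open)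
    fix N :: nat assume "N \<in> {1..}"
    thus "f holomorphic_on {s. Re s > 1 - of_nat N}"
      by (intro holomorphic_transform[OF hol[of N]]) (use f_eq in auto)
  qed (rule open_halfspace_Re_gt)
  moreover have "(\<Union>N\<in>{1..}. {s. Re s > 1 - of_nat N}) = UNIV"
  proof -
    have "\<exists>N\<ge>1. Re s > 1 - of_nat N" for s
      by (intro exI[of _ "nat \<lceil>\<bar>Re s\<bar>\<rceil> + 2"]) linarith
    thus ?thesis by auto
  qed
  ultimately have "f holomorphic_on UNIV"
    by simp
  moreover have "f s = g s" if "Re s > 1" for s
    using f_eq[of 1 s] eq[of 1 s] that by simp
  ultimately show ?thesis
    by blast
qed

lemma hurwitz_zeta_series_sums:
  assumes "a > 0" "Re s > 1"
  shows "(\<lambda>k. of_real (of_nat k + a) powr (- s)) sums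
           (\<Sum>k. of_real (of_nat k + a) powr (- s))"
proof -
  have "summable (\<lambda>k. (1 - s) * of_real (of_nat k + a) powr (- s))"
    using hurwitz_continuation_strip(2)[OF assms(1) order_refl assms(2)] by (rule sums_summable)
  moreover have "1 - s \<noteq> 0"
    using assms by auto
  ultimately have "summable (\<lambda>k. of_real (of_nat k + a) powr (- s))"
    by (simp add: summable_cmult_iff)
  thus ?thesis
    by (rule summable_sums)
qed

text \<open>
  The choice in the definition of \<open>hurwitz_zeta\<close> is meaningful because a continuation exists: the
  entire function glued from the half-planes, divided by \<open>1 - s\<close>.
\<close>

lemma hurwitz_zeta_holomorphic_and_eq:
  fixes s :: complex
  assumes a: "a > 0"
  shows hurwitz_zeta_holomorphic: "hurwitz_zeta a holomorphic_on (- {1})"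
    and hurwitz_zeta_eq:
      "Re s > 1 \<Longrightarrow> hurwitz_zeta a s = (\<Sum>k. of_real (of_nat k + a) powr (- s))"
proof -
  define g :: "complex \<Rightarrow> complex"
    where "g = (\<lambda>s. (1 - s) * (\<Sum>k. of_real (of_nat k + a) powr (- s)))"
  define Z where "Z = (\<lambda>N s. - (\<Sum>j\<le>N. fps_nth bernoulli_coeffs j * powr_tower (s - 1) j (of_real a))
        - (\<Sum>k. step_defect bernoulli_coeffs N (powr_tower (s - 1)) (of_real (of_nat k + a))))"
  have Z_hol: "Z N holomorphic_on {s. Re s > 1 - of_nat N}" if "N \<ge> 1" for N
    unfolding Z_def by (rule hurwitz_continuation_strip(1)[OF a that])
  have Z_eq: "Z N s = g s" if N: "N \<ge> 1" and s: "Re s > 1" for N s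
  proof -
    have "(\<lambda>k. (1 - s) * of_real (of_nat k + a) powr (- s)) sums g s"
      unfolding g_def using a s by (intro sums_mult hurwitz_zeta_series_sums)
    with hurwitz_continuation_strip(2)[OF a N s] show ?thesis
      unfolding Z_def by (rule sums_unique2)
  qed
  obtain f where f: "f holomorphic_on UNIV" "\<And>s. Re s > 1 \<Longrightarrow> f s = g s"
    using holomorphic_glue_halfplanes[of Z g, OF Z_hol Z_eq] by blast
  have "\<exists>f. f holomorphic_on (- {1}) \<and>
     (\<forall>s. Re s > 1 \<longrightarrow> f s = (\<Sum>k::nat. of_real (real k + a) powr (- s)))"
  proof (intro exI[of _ "\<lambda>s. f s / (1 - s)"] conjI allI impI)
    show "(\<lambda>s. f s / (1 - s)) holomorphic_on (- {1})"
      by (intro holomorphic_intros holomorphic_on_subset[OF f(1)]) auto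
    fix s :: complex assume "Re s > 1"
    moreover from this have "1 - s \<noteq> 0" by auto
    ultimately show "f s / (1 - s) = (\<Sum>k::nat. of_real (real k + a) powr (- s))"
      by (simp add: f(2) g_def)
  qed
  hence "hurwitz_zeta a holomorphic_on (- {1}) \<and>
     (\<forall>s. Re s > 1 \<longrightarrow> hurwitz_zeta a s = (\<Sum>k::nat. of_real (real k + a) powr (- s)))"
    unfolding hurwitz_zeta_def by (rule someI_ex)
  thus "hurwitz_zeta a holomorphic_on (- {1})"
    and "Re s > 1 \<Longrightarrow> hurwitz_zeta a s = (\<Sum>k. of_real (of_nat k + a) powr (- s))"
    by blast+
qed

text \<open>
  Boole summation: the boundary term \<open>F s y\<close> and the sum of the defects are both holomorphic for
  \<open>Re s > -N\<close>, and together they equal the alternating series wherever that series converges.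
\<close>

lemma alternating_continuation:
  fixes N :: nat
  assumes y: "y > 0"
  defines "F \<equiv> \<lambda>s z. \<Sum>j\<le>N. fps_nth euler_coeffs j * powr_tower s j z"
  defines "A \<equiv> \<lambda>s. F s (of_real y)
    - (\<Sum>k. (- 1) ^ k * step_defect euler_coeffs N (powr_tower s) (of_real (of_nat k + y)))"
  shows "A holomorphic_on {s. Re s > - of_nat N}"
    and "Re s > 0 \<Longrightarrow> (\<lambda>k. (- 1) ^ k * of_real (of_nat k + y) powr (- s)) sums A s"
proof -
  define E where "E = (\<lambda>s k. step_defect euler_coeffs N (powr_tower s) (of_real (of_nat k + y)))"
  have hol: "(\<lambda>s. \<Sum>k. (- 1) ^ k * E s k) holomorphic_on {s. Re s > - of_nat N}"
    unfolding E_def by (rule step_defect_powr_tower_sum_holomorphic[OF y]) (simp add: norm_power)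
  thus "A holomorphic_on {s. Re s > - of_nat N}"
    unfolding A_def F_def E_def by (intro holomorphic_intros holomorphic_on_powr_tower)
  show "(\<lambda>k. (- 1) ^ k * of_real (of_nat k + y) powr (- s)) sums A s" if s: "Re s > 0"
  proof -
    have "(\<lambda>k. F s (of_real (of_nat k + y))) \<longlonglongrightarrow> (\<Sum>j\<le>N. fps_nth euler_coeffs j * 0)"
      unfolding F_def using s y by (intro tendsto_intros powr_tower_tendsto_0) auto
    hence "(\<lambda>k. F s (of_real (of_nat k + y))) \<longlonglongrightarrow> 0"
      by simp
    hence "(\<lambda>k. (- 1) ^ k * F s (of_real (of_nat k + y))) \<longlonglongrightarrow> 0"
      by (rule Lim_null_comparison[rotated, OF tendsto_norm_zero]) (simp add: norm_mult norm_power)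
    hence "(\<lambda>k. (- 1) ^ k * F s (of_real (of_nat k + y)) -
                 (- 1) ^ Suc k * F s (of_real (of_nat (Suc k) + y))) sums
             ((- 1) ^ 0 * F s (of_real (of_nat 0 + y)) - 0)"
      by (rule telescope_sums')
    moreover have "(\<lambda>k. (- 1) ^ k * E s k) sums (\<Sum>k. (- 1) ^ k * E s k)"
      unfolding E_def using s
      by (intro summable_sums step_defect_powr_tower_summable[OF y]) (auto simp: norm_power)
    ultimately have "(\<lambda>k. (- 1) ^ k * F s (of_real (of_nat k + y)) -
                 (- 1) ^ Suc k * F s (of_real (of_nat (Suc k) + y)) - (- 1) ^ k * E s k) sums
             ((- 1) ^ 0 * F s (of_real (of_nat 0 + y)) - 0 - (\<Sum>k. (- 1) ^ k * E s k))"
      by (rule sums_diff)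
    moreover have "(- 1) ^ k * F s (of_real (of_nat k + y)) -
                 (- 1) ^ Suc k * F s (of_real (of_nat (Suc k) + y)) - (- 1) ^ k * E s k
        = (- 1) ^ k * of_real (of_nat k + y) powr (- s)" for k
      by (simp add: E_def F_def step_defect_euler_coeffs algebra_simps)
    ultimately show ?thesis
      by (simp add: A_def E_def)
  qed
qed

text \<open>
  One half of the \<open>p\<close>-th Euler polynomial, in the form \<open>c(D) z^p\<close> at \<open>z = y\<close> with
  \<open>c = euler_coeffs\<close>: this is how the boundary term of Boole summation presents it.
\<close>

definition half_euler_poly :: "nat \<Rightarrow> real \<Rightarrow> complex" where
  "half_euler_poly p y = (\<Sum>j\<le>p. fps_nth euler_coeffs j *
     ((\<Prod>i<j. of_nat p - of_nat i) * of_real y ^ (p - j)))"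

lemma half_euler_poly_eq:
  assumes "N \<ge> p"
    and "\<And>j. j \<le> p \<Longrightarrow> f j = (\<Prod>i<j. of_nat p - of_nat i) * of_real y ^ (p - j)"
    and "\<And>j. j > p \<Longrightarrow> f j = 0"
  shows "(\<Sum>j\<le>N. fps_nth euler_coeffs j * f j) = half_euler_poly p y"
proof -
  have "(\<Sum>j\<le>N. fps_nth euler_coeffs j * f j) = (\<Sum>j\<le>p. fps_nth euler_coeffs j * f j)"
    by (rule sum.mono_neutral_right) (use assms in auto)
  also have "\<dots> = half_euler_poly p y"
    unfolding half_euler_poly_def by (intro sum.cong) (use assms in auto)
  finally show ?thesis .
qed

lemma prod_falling_zero: "j > p \<Longrightarrow> (\<Prod>i<j. of_nat p - of_nat i :: complex) = 0"
  by (rule prod_zero) auto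

lemma powr_tower_neg_nat:
  assumes "y > 0"
  shows "j \<le> p \<Longrightarrow> powr_tower (- of_nat p) j (of_real y) = (\<Prod>i<j. of_nat p - of_nat i) * of_real y ^ (p - j)"
    and "j > p \<Longrightarrow> powr_tower (- of_nat p) j z = 0"
proof -
  assume "j \<le> p"
  hence "of_nat p - of_nat j = (of_nat (p - j) :: complex)" by (simp add: of_nat_diff)
  thus "powr_tower (- of_nat p) j (of_real y) = (\<Prod>i<j. of_nat p - of_nat i) * of_real y ^ (p - j)"
    using assms by (simp add: powr_tower_def)
next
  assume "j > p"
  thus "powr_tower (- of_nat p) j z = 0"
    using prod_falling_zero[of p j] by (simp add: powr_tower_def)
qed

text \<open>
  Separating even and odd \<open>k\<close> gives
  \<open>\<zeta>(s, y/2) - \<zeta>(s, (y + 1)/2) = 2^s \<Sum>k. (-1)^k (k + y)^(-s)\<close> for \<open>Re s > 1\<close>, and the identity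
  theorem carries this to \<open>s = -p\<close>. There \<open>z powr (-s)\<close> is a polynomial of degree \<open>p\<close>, so with
  \<open>N > p\<close> all defects vanish and only the boundary term remains.
\<close>

lemma hurwitz_zeta_diff_neg_nat:
  assumes y: "y > 0"
  shows "hurwitz_zeta (y / 2) (- of_nat p) - hurwitz_zeta ((y + 1) / 2) (- of_nat p)
           = half_euler_poly p y / 2 ^ p"
proof -
  define N where "N = p + 1"
  define A where "A = (\<lambda>s. (\<Sum>j\<le>N. fps_nth euler_coeffs j * powr_tower s j (of_real y))
    - (\<Sum>k. (- 1) ^ k * step_defect euler_coeffs N (powr_tower s) (of_real (of_nat k + y))))"
  define D where "D = {s. Re s > - of_nat N} - {1}"
  have "hurwitz_zeta (y / 2) (- of_nat p) - hurwitz_zeta ((y + 1) / 2) (- of_nat p)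
          = 2 powr (- of_nat p) * A (- of_nat p)"
  proof (rule analytic_continuation_open[of "{s. Re s > 1}" D
      "\<lambda>s. hurwitz_zeta (y / 2) s - hurwitz_zeta ((y + 1) / 2) s" "\<lambda>s. 2 powr s * A s"])
    show "open {s. Re s > 1}" "open D"
      unfolding D_def by (intro open_Diff open_halfspace_Re_gt closed_singleton | simp add: open_halfspace_Re_gt)+
    show "connected D"
      unfolding D_def
      by (intro connected_open_delete convex_connected convex_halfspace_Re_gt open_halfspace_Re_gt) simp
    have "Re 2 > 1" by simp
    thus "{s. Re s > 1} \<noteq> {}" by blast
    show "{s. Re s > 1} \<subseteq> D"
      by (auto simp: D_def)
    show "(\<lambda>s. hurwitz_zeta (y / 2) s - hurwitz_zeta ((y + 1) / 2) s) holomorphic_on D"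
      using y by (intro holomorphic_intros holomorphic_on_subset[OF hurwitz_zeta_holomorphic])
        (auto simp: D_def)
    show "(\<lambda>s. 2 powr s * A s) holomorphic_on D"
      unfolding A_def
      by (intro holomorphic_intros holomorphic_on_powr_right holomorphic_on_subset[OF alternating_continuation(1)[OF y]])
         (auto simp: D_def)
    show "- of_nat p \<in> D"
      by (auto simp: D_def N_def complex_eq_iff)
    fix s :: complex assume "s \<in> {s. Re s > 1}"
    hence s: "Re s > 1" by simp
    have half: "of_real (x / 2) powr (- s) = 2 powr s * of_real x powr (- s)" if "x > 0" for x
    proof -
      have "of_real (x / 2) powr (- s) = (of_real x * of_real (1 / 2)) powr (- s)"
        by simp
      also have "\<dots> = of_real x powr (- s) * of_real (1 / 2) powr (- s)"
        using that by (intro powr_times_real) auto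
      also have "of_real (1 / 2) powr (- s) = 2 powr s"
        by (simp add: powr_def Ln_inverse[of 2, simplified inverse_eq_divide] )
      finally show ?thesis by simp
    qed
    have "(\<lambda>k. of_real (of_nat k + y / 2) powr (- s) - of_real (of_nat k + (y + 1) / 2) powr (- s))
            sums (hurwitz_zeta (y / 2) s - hurwitz_zeta ((y + 1) / 2) s)"
      using sums_diff[OF hurwitz_zeta_series_sums[of "y / 2" s] hurwitz_zeta_series_sums[of "(y + 1) / 2" s]] y s
      by (simp add: hurwitz_zeta_eq)
    moreover have "of_real (of_nat k + y / 2) powr (- s) - of_real (of_nat k + (y + 1) / 2) powr (- s)
        = 2 powr s * (of_real (of_nat (2 * k) + y) powr (- s) - of_real (of_nat (2 * k + 1) + y) powr (- s))" for k
      using half[of "of_nat (2 * k) + y"] half[of "of_nat (2 * k + 1) + y"] y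
      by (simp add: add_divide_distrib algebra_simps)
    ultimately have "(\<lambda>k. 2 powr s * (of_real (of_nat (2 * k) + y) powr (- s) - of_real (of_nat (2 * k + 1) + y) powr (- s)))
            sums (hurwitz_zeta (y / 2) s - hurwitz_zeta ((y + 1) / 2) s)"
      by simp
    moreover have "(\<lambda>k. 2 powr s * (of_real (of_nat (2 * k) + y) powr (- s) - of_real (of_nat (2 * k + 1) + y) powr (- s)))
            sums (2 powr s * A s)"
    proof (rule sums_mult)
      have "(\<lambda>k. (- 1) ^ k * of_real (of_nat k + y) powr (- s)) sums A s"
        unfolding A_def using s by (intro alternating_continuation(2)[OF y]) auto
      from sums_group[OF this, of 2]
      show "(\<lambda>k. of_real (of_nat (2 * k) + y) powr (- s) - of_real (of_nat (2 * k + 1) + y) powr (- s)) sums A s"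
        by (simp add: numeral_2_eq_2 mult.commute[of _ "Suc (Suc 0)"] power_add power_mult algebra_simps)
    qed
    ultimately show "hurwitz_zeta (y / 2) s - hurwitz_zeta ((y + 1) / 2) s = 2 powr s * A s"
      by (rule sums_unique2)
  qed
  also have "A (- of_nat p) = half_euler_poly p y"
  proof -
    have "step_defect euler_coeffs N (powr_tower (- of_nat p)) (of_real (of_nat k + y)) = 0" for k
    proof -
      have "norm (step_defect euler_coeffs N (powr_tower (- of_nat p)) (of_real (of_nat k + y))) \<le>
        (\<Sum>j\<le>N. norm (fps_nth euler_coeffs j)) *
        ((\<Prod>i<Suc N. norm (- of_nat p + of_nat i :: complex)) * (of_nat k + y) powr (- Re (- of_nat p) - of_nat N - 1))"
        using y by (intro norm_step_defect_powr_tower_le) (auto simp: N_def)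
      moreover have "(\<Prod>i<Suc N. norm (- of_nat p + of_nat i :: complex)) = 0"
        by (rule prod_zero) (auto simp: N_def)
      ultimately have "norm (step_defect euler_coeffs N (powr_tower (- of_nat p)) (of_real (of_nat k + y))) \<le> 0"
        by (simp only: mult_zero_left mult_zero_right)
      thus ?thesis
        by simp
    qed
    moreover have "(\<Sum>j\<le>N. fps_nth euler_coeffs j * powr_tower (- of_nat p) j (of_real y)) = half_euler_poly p y"
      by (rule half_euler_poly_eq) (use powr_tower_neg_nat[OF y] in \<open>auto simp: N_def\<close>)
    ultimately show ?thesis
      by (simp add: A_def)
  qed
  also have "2 powr (- of_nat p) = 1 / (2 ^ p :: complex)"
    by (simp add: powr_minus divide_simps)
  finally show ?thesis by simp
qed

section \<open>Alternating power sums with Gaussian damping\<close>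

text \<open>
  The \<open>j\<close>-th derivative in \<open>z\<close> of \<open>\<tau>^a z^b exp(-\<tau> z\<^sup>2)\<close>, organised by the product rule. The point of
  the exponent \<open>a\<close> is homogeneity: each derivative lowers the weight \<open>b - 2a\<close> by exactly one,
  which yields bounds uniform in \<open>\<tau>\<close>. In the case \<open>b = 0\<close> the truncated exponent \<open>b - 1\<close> has
  coefficient \<open>0\<close>.
\<close>

primrec gaussian_tower :: "nat \<Rightarrow> nat \<Rightarrow> nat \<Rightarrow> real \<Rightarrow> complex \<Rightarrow> complex" where
  "gaussian_tower 0 a b \<tau> z = of_real \<tau> ^ a * z ^ b * exp (- (of_real \<tau> * z\<^sup>2))"
| "gaussian_tower (Suc j) a b \<tau> z = of_nat b * gaussian_tower j a (b - 1) \<tau> z - 2 * gaussian_tower j (Suc a) (Suc b) \<tau> z"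

lemma has_field_derivative_gaussian_tower: "(gaussian_tower j a b \<tau> has_field_derivative gaussian_tower (Suc j) a b \<tau> z) (at z)"
proof (induction j arbitrary: a b)
  case 0
  have "((\<lambda>z. of_real \<tau> ^ a * z ^ b * exp (- (of_real \<tau> * z\<^sup>2))) has_field_derivative
      of_real \<tau> ^ a * (of_nat b * z ^ (b - 1)) * exp (- (of_real \<tau> * z\<^sup>2))
      + of_real \<tau> ^ a * z ^ b * (exp (- (of_real \<tau> * z\<^sup>2)) * - (of_real \<tau> * (2 * z)))) (at z)"
    by (auto intro!: derivative_eq_intros simp: power2_eq_square algebra_simps)
  moreover have "gaussian_tower 0 a b \<tau> = (\<lambda>z. of_real \<tau> ^ a * z ^ b * exp (- (of_real \<tau> * z\<^sup>2)))"
    by (rule ext) simp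
  ultimately show ?case
    by (simp add: algebra_simps)
next
  case (Suc j)
  have eq: "gaussian_tower (Suc j) a b \<tau> = (\<lambda>z. of_nat b * gaussian_tower j a (b - 1) \<tau> z - 2 * gaussian_tower j (Suc a) (Suc b) \<tau> z)"
    by (rule ext) simp
  show ?case
    unfolding eq gaussian_tower.simps(2)[of "Suc j" a b] by (intro DERIV_diff DERIV_cmult Suc.IH)
qed

lemma power_mult_exp_minus_le:
  assumes "u \<ge> 0"
  shows "u ^ a * exp (- u) \<le> (fact a :: real)"
proof -
  have "(\<lambda>i. u ^ i /\<^sub>R fact i) sums exp u"
    by (rule exp_converges)
  hence "(\<Sum>i\<in>{a}. u ^ i /\<^sub>R fact i) \<le> exp u"
    using sum_le_suminf[of "\<lambda>i. u ^ i /\<^sub>R fact i" "{a}"] assms by (simp add: sums_iff)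
  thus ?thesis
    by (simp add: exp_minus field_simps)
qed

text \<open>
  With \<open>v = \<tau> x\<^sup>2\<close> one has \<open>\<tau>^a x^b = v^a x^(b - 2a)\<close>, and \<open>v^a exp(-v)\<close> is at most \<open>a!\<close>. The bound
  does not depend on \<open>\<tau>\<close>.
\<close>

lemma norm_gaussian_tower_0_le:
  assumes "\<tau> \<ge> 0" "x > 0"
  shows "norm (gaussian_tower 0 a b \<tau> (of_real x)) \<le> fact a * x powr (of_nat b - 2 * of_nat a)"
proof -
  have "gaussian_tower 0 a b \<tau> (of_real x) = of_real (\<tau> ^ a * x ^ b * exp (- (\<tau> * x\<^sup>2)))"
    by (simp add: exp_of_real[symmetric])
  hence "norm (gaussian_tower 0 a b \<tau> (of_real x)) = \<tau> ^ a * x ^ b * exp (- (\<tau> * x\<^sup>2))"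
    using assms by (simp add: norm_mult norm_power)
  also have "\<dots> = x powr (of_nat b - 2 * of_nat a) * ((\<tau> * x\<^sup>2) ^ a * exp (- (\<tau> * x\<^sup>2)))"
  proof -
    have "x ^ b = x powr (of_nat b - 2 * of_nat a) * x powr of_nat (2 * a)"
      using assms(2) by (simp add: powr_realpow[symmetric] powr_add[symmetric] del: of_nat_mult) simp
    hence "x ^ b = x powr (of_nat b - 2 * of_nat a) * x ^ (2 * a)"
      using assms(2) by (simp add: powr_realpow del: of_nat_mult)
    thus ?thesis
      by (simp add: power_mult_distrib power_mult[symmetric])
  qed
  also have "\<dots> \<le> x powr (of_nat b - 2 * of_nat a) * fact a"
    using assms by (intro mult_left_mono power_mult_exp_minus_le) auto
  finally show ?thesis
    by (simp add: mult.commute)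
qed

lemma norm_gaussian_tower_le:
  "\<exists>C. \<forall>\<tau>\<ge>0. \<forall>x>0. norm (gaussian_tower j a b \<tau> (of_real x)) \<le> C * x powr (of_nat b - 2 * of_nat a - of_nat j)"
proof (induction j arbitrary: a b)
  case 0
  show ?case
    using norm_gaussian_tower_0_le[of _ _ a b] by (intro exI[of _ "fact a"]) auto
next
  case (Suc j)
  obtain C1 where C1: "norm (gaussian_tower j a (b - 1) \<tau> (of_real x)) \<le>
      C1 * x powr (of_nat (b - 1) - 2 * of_nat a - of_nat j)" if "\<tau> \<ge> 0" "x > 0" for \<tau> x
    using Suc.IH[of a "b - 1"] by blast
  obtain C2 where C2: "norm (gaussian_tower j (Suc a) (Suc b) \<tau> (of_real x)) \<le>
      C2 * x powr (of_nat (Suc b) - 2 * of_nat (Suc a) - of_nat j)" if "\<tau> \<ge> 0" "x > 0" for \<tau> x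
    using Suc.IH[of "Suc a" "Suc b"] by blast
  show ?case
  proof (intro exI[of _ "of_nat b * C1 + 2 * C2"] allI impI)
    fix \<tau> x :: real assume \<tau>: "\<tau> \<ge> 0" and x: "x > 0"
    have "norm (gaussian_tower (Suc j) a b \<tau> (of_real x)) \<le>
        of_nat b * norm (gaussian_tower j a (b - 1) \<tau> (of_real x)) + 2 * norm (gaussian_tower j (Suc a) (Suc b) \<tau> (of_real x))"
      unfolding gaussian_tower.simps(2) by (rule order_trans[OF norm_triangle_ineq4]) (simp add: norm_mult)
    also have "of_nat b * norm (gaussian_tower j a (b - 1) \<tau> (of_real x)) \<le>
        of_nat b * C1 * x powr (of_nat b - 2 * of_nat a - of_nat (Suc j))"
    proof (cases "b = 0")
      case False
      thus ?thesis
        using mult_left_mono[OF C1[OF \<tau> x], of "of_nat b"] by (simp add: of_nat_diff algebra_simps)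
    qed simp
    also have "2 * norm (gaussian_tower j (Suc a) (Suc b) \<tau> (of_real x)) \<le>
        2 * C2 * x powr (of_nat b - 2 * of_nat a - of_nat (Suc j))"
      using C2[OF \<tau> x] by (simp add: algebra_simps)
    finally show "norm (gaussian_tower (Suc j) a b \<tau> (of_real x)) \<le>
        (of_nat b * C1 + 2 * C2) * x powr (of_nat b - 2 * of_nat a - of_nat (Suc j))"
      by (simp add: algebra_simps)
  qed
qed

text \<open>
  For fixed \<open>\<tau> > 0\<close> powers of \<open>\<tau>\<close> may be traded for decay in \<open>x\<close>: the preceding uniform bound
  with \<open>a\<close> replaced by \<open>b + 1\<close> has a negative exponent.
\<close>

lemma gaussian_tower_tendsto_0:
  assumes \<tau>: "\<tau> > 0" and y: "y > 0"
  shows "(\<lambda>k. gaussian_tower j a b \<tau> (of_real (of_nat k + y))) \<longlonglongrightarrow> 0"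
proof (induction j arbitrary: a b)
  case 0
  have "(\<lambda>k. (of_nat k + y) powr (of_nat b - 2 * of_nat (Suc b))) \<longlonglongrightarrow> 0"
    by (rule tendsto_neg_powr[OF _ add_const_at_top]) simp
  hence "(\<lambda>k. fact (Suc b) * (of_nat k + y) powr (of_nat b - 2 * of_nat (Suc b))) \<longlonglongrightarrow> 0"
    by (rule tendsto_mult_right_zero)
  hence "(\<lambda>k. gaussian_tower 0 (Suc b) b \<tau> (of_real (of_nat k + y))) \<longlonglongrightarrow> 0"
    by (rule Lim_null_comparison[rotated])
       (use norm_gaussian_tower_0_le[of \<tau> _ "Suc b" b] \<tau> y in \<open>auto intro!: always_eventually simp del: gaussian_tower.simps of_real_add\<close>)
  hence "(\<lambda>k. of_real (\<tau> ^ a / \<tau> ^ Suc b) * gaussian_tower 0 (Suc b) b \<tau> (of_real (of_nat k + y))) \<longlonglongrightarrow> 0"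
    by (rule tendsto_mult_right_zero)
  moreover have "of_real (\<tau> ^ a / \<tau> ^ Suc b) * gaussian_tower 0 (Suc b) b \<tau> z = gaussian_tower 0 a b \<tau> z" for z
    using \<tau> by simp
  ultimately show ?case
    by simp
next
  case (Suc j)
  have "(\<lambda>k. of_nat b * gaussian_tower j a (b - 1) \<tau> (of_real (of_nat k + y))
          - 2 * gaussian_tower j (Suc a) (Suc b) \<tau> (of_real (of_nat k + y))) \<longlonglongrightarrow> of_nat b * 0 - 2 * 0"
    by (intro tendsto_intros Suc.IH)
  thus ?case
    by simp
qed

lemma gaussian_tower_tendsto: "((\<lambda>\<tau>. gaussian_tower j a b \<tau> z) \<longlongrightarrow> gaussian_tower j a b 0 z) (at 0 within S)"
proof (induction j arbitrary: a b)
  case 0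
  show ?case
    unfolding gaussian_tower.simps by (intro tendsto_intros)
next
  case (Suc j)
  show ?case
    unfolding gaussian_tower.simps(2) by (intro tendsto_intros Suc.IH)
qed

lemma gaussian_tower_at_0:
  "gaussian_tower j a b 0 z = (if a = 0 then (\<Prod>i<j. of_nat b - of_nat i) * z ^ (b - j) else 0)"
proof (induction j arbitrary: a b)
  case 0
  show ?case by (simp add: power_0_left)
next
  case (Suc j)
  show ?case
  proof (cases b)
    case (Suc b')
    thus ?thesis
      by (simp add: Suc.IH prod.lessThan_Suc_shift del: prod.lessThan_Suc)
  qed (simp add: Suc.IH prod.lessThan_Suc_shift del: prod.lessThan_Suc)
qed

text \<open>
  Boole summation for \<open>x^p exp(-\<tau> x\<^sup>2)\<close>. The order \<open>N = p + 1\<close> is the least for which the derivative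
  of order \<open>N + 1\<close> is \<open>O(x^(-2))\<close> uniformly in \<open>\<tau>\<close>, so that the remainder has a summable
  majorant that survives the limit \<open>\<tau> \<rightarrow> 0\<close>.
\<close>

lemma alternating_gaussian_sums:
  fixes N :: nat and p :: nat
  assumes y: "y > 0" and N: "N = p + 1"
  defines "F \<equiv> \<lambda>\<tau> z. \<Sum>j\<le>N. fps_nth euler_coeffs j * gaussian_tower j 0 p \<tau> z"
  defines "E \<equiv> \<lambda>\<tau> k. step_defect euler_coeffs N (\<lambda>j. gaussian_tower j 0 p \<tau>) (of_real (of_nat k + y))"
  shows alternating_gaussian_remainder_bound:
      "\<exists>M. summable M \<and> (\<forall>\<tau>\<ge>0. \<forall>k\<ge>1. norm ((- 1) ^ k * E \<tau> k) \<le> M k)"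
    and alternating_gaussian_eq:
      "\<tau> > 0 \<Longrightarrow> (\<lambda>k. (- 1) ^ k * of_real ((of_nat k + y) ^ p * exp (- (\<tau> * (of_nat k + y)\<^sup>2)))) sums
         (F \<tau> (of_real y) - (\<Sum>k. (- 1) ^ k * E \<tau> k))"
proof -
  obtain C where C: "norm (gaussian_tower (Suc N) 0 p \<tau> (of_real x)) \<le> C * x powr (- 2)"
    if "\<tau> \<ge> 0" "x > 0" for \<tau> x
    using norm_gaussian_tower_le[of "Suc N" 0 p] unfolding N by auto
  define K where "K = (\<Sum>j\<le>N. norm (fps_nth euler_coeffs j))"
  have C_nonneg: "C \<ge> 0"
    using order_trans[OF norm_ge_zero C[of 0 1]] by simp
  have bound: "norm ((- 1) ^ k * E \<tau> k) \<le> K * (C * of_nat k powr (- 2))" if "\<tau> \<ge> 0" "k \<ge> 1" for \<tau> k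
  proof -
    have "norm (E \<tau> k) \<le> K * (C * of_nat k powr (- 2))"
      unfolding E_def K_def
    proof (rule norm_step_defect_le)
      fix w assume "w \<in> closed_segment (complex_of_real (of_nat k + y)) (of_real (of_nat k + y) + 1)"
      then obtain t where t: "w = of_real t" "of_nat k + y \<le> t"
        by (elim of_real_in_unit_segment)
      have "norm (gaussian_tower (Suc N) 0 p \<tau> w) \<le> C * t powr (- 2)"
        unfolding t(1) using t(2) y by (intro C that) auto
      also have "\<dots> \<le> C * of_nat k powr (- 2)"
        using t(2) y that C_nonneg by (intro mult_left_mono powr_mono2') auto
      finally show "norm (gaussian_tower (Suc N) 0 p \<tau> w) \<le> C * of_nat k powr (- 2)" .
    qed (rule has_field_derivative_gaussian_tower)
    thus ?thesis
      by (simp add: norm_mult norm_power)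
  qed
  have summable: "summable (\<lambda>k. K * (C * of_nat k powr (- 2)))"
    by (intro summable_mult) (simp add: summable_real_powr_iff)
  show "\<exists>M. summable M \<and> (\<forall>\<tau>\<ge>0. \<forall>k\<ge>1. norm ((- 1) ^ k * E \<tau> k) \<le> M k)"
    using summable bound by blast
  show "(\<lambda>k. (- 1) ^ k * of_real ((of_nat k + y) ^ p * exp (- (\<tau> * (of_nat k + y)\<^sup>2)))) sums
         (F \<tau> (of_real y) - (\<Sum>k. (- 1) ^ k * E \<tau> k))" if \<tau>: "\<tau> > 0"
  proof -
    have "(\<lambda>k. F \<tau> (of_real (of_nat k + y))) \<longlonglongrightarrow> (\<Sum>j\<le>N. fps_nth euler_coeffs j * 0)"
      unfolding F_def by (intro tendsto_intros gaussian_tower_tendsto_0 \<tau> y)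
    hence "(\<lambda>k. F \<tau> (of_real (of_nat k + y))) \<longlonglongrightarrow> 0"
      by simp
    hence "(\<lambda>k. (- 1) ^ k * F \<tau> (of_real (of_nat k + y))) \<longlonglongrightarrow> 0"
      by (rule Lim_null_comparison[rotated, OF tendsto_norm_zero]) (simp add: norm_mult norm_power)
    hence "(\<lambda>k. (- 1) ^ k * F \<tau> (of_real (of_nat k + y)) -
                 (- 1) ^ Suc k * F \<tau> (of_real (of_nat (Suc k) + y))) sums
             ((- 1) ^ 0 * F \<tau> (of_real (of_nat 0 + y)) - 0)"
      by (rule telescope_sums')
    moreover have "(\<lambda>k. (- 1) ^ k * E \<tau> k) sums (\<Sum>k. (- 1) ^ k * E \<tau> k)"
      by (rule summable_sums[OF summable_comparison_test_ev[OF _ summable]])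
         (use bound \<tau> in \<open>auto intro!: eventually_mono[OF eventually_ge_at_top[of 1]]\<close>)
    ultimately have "(\<lambda>k. (- 1) ^ k * F \<tau> (of_real (of_nat k + y)) -
                 (- 1) ^ Suc k * F \<tau> (of_real (of_nat (Suc k) + y)) - (- 1) ^ k * E \<tau> k) sums
             ((- 1) ^ 0 * F \<tau> (of_real (of_nat 0 + y)) - 0 - (\<Sum>k. (- 1) ^ k * E \<tau> k))"
      by (rule sums_diff)
    moreover have "(- 1) ^ k * F \<tau> (of_real (of_nat k + y)) -
                 (- 1) ^ Suc k * F \<tau> (of_real (of_nat (Suc k) + y)) - (- 1) ^ k * E \<tau> k
        = (- 1) ^ k * of_real ((of_nat k + y) ^ p * exp (- (\<tau> * (of_nat k + y)\<^sup>2)))" for k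
    proof -
      have "(- 1) ^ k * F \<tau> (of_real (of_nat k + y)) -
                 (- 1) ^ Suc k * F \<tau> (of_real (of_nat (Suc k) + y)) - (- 1) ^ k * E \<tau> k
          = (- 1) ^ k * gaussian_tower 0 0 p \<tau> (of_real (of_nat k + y))"
        by (simp add: E_def F_def step_defect_euler_coeffs algebra_simps del: gaussian_tower.simps)
      thus ?thesis
        by (simp add: exp_of_real[symmetric])
    qed
    ultimately show ?thesis
      by simp
  qed
qed

text \<open>
  By dominated convergence for series (Tannery's theorem) the limit may be taken inside the sum of
  the defects. At \<open>\<tau> = 0\<close> the function is the polynomial \<open>x^p\<close>, whose defects vanish, and the
  boundary term becomes one half of the Euler polynomial.
\<close>

lemma alternating_gaussian_limit:
  assumes y: "y > 0"
  shows "((\<lambda>\<tau>. \<Sum>k. (- 1) ^ k * of_real ((of_nat k + y) ^ p * exp (- (\<tau> * (of_nat k + y)\<^sup>2))))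
           \<longlongrightarrow> half_euler_poly p y) (at_right 0)"
proof -
  define N where "N = p + 1"
  define F where "F = (\<lambda>\<tau> z. \<Sum>j\<le>N. fps_nth euler_coeffs j * gaussian_tower j 0 p \<tau> z)"
  define E where "E = (\<lambda>\<tau> k. step_defect euler_coeffs N (\<lambda>j. gaussian_tower j 0 p \<tau>) (of_real (of_nat k + y)))"
  obtain M where M: "summable M" "\<And>\<tau> k. \<tau> \<ge> 0 \<Longrightarrow> k \<ge> 1 \<Longrightarrow> norm ((- 1) ^ k * E \<tau> k) \<le> M k"
    using alternating_gaussian_remainder_bound[OF y N_def] unfolding E_def by metis
  have E0: "E 0 k = 0" for k
  proof -
    have "norm (E 0 k) \<le> (\<Sum>j\<le>N. norm (fps_nth euler_coeffs j)) * 0"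
      unfolding E_def
    proof (rule norm_step_defect_le)
      have "gaussian_tower (Suc N) 0 p 0 w = 0" for w
        using prod_falling_zero[of p "Suc N"] by (simp add: gaussian_tower_at_0 N_def del: gaussian_tower.simps)
      thus "norm (gaussian_tower (Suc N) 0 p 0 w) \<le> 0" for w
        by simp
    qed (rule has_field_derivative_gaussian_tower)
    thus ?thesis by simp
  qed
  have "((\<lambda>\<tau>. \<Sum>k. (- 1) ^ k * E \<tau> k) \<longlongrightarrow> (\<Sum>k. 0)) (at_right 0)"
  proof (rule tannerys_theorem[THEN conjunct2, THEN conjunct2])
    fix k
    have "((\<lambda>\<tau>. E \<tau> k) \<longlongrightarrow> E 0 k) (at_right 0)"
      unfolding E_def step_defect_def by (intro tendsto_intros gaussian_tower_tendsto)
    thus "((\<lambda>\<tau>. (- 1) ^ k * E \<tau> k) \<longlongrightarrow> 0) (at_right 0)"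
      unfolding E0 by (rule tendsto_mult_right_zero)
  next
    show "\<forall>\<^sub>F (k, \<tau>) in sequentially \<times>\<^sub>F at_right 0. norm ((- 1) ^ k * E \<tau> k) \<le> M k"
      by (rule eventually_mono[OF eventually_prodI[OF eventually_ge_at_top[of 1] eventually_at_right_less[of 0]]])
         (use M(2) in \<open>auto simp: less_imp_le\<close>)
  qed (use M(1) in auto)
  moreover have "((\<lambda>\<tau>. F \<tau> (of_real y)) \<longlongrightarrow> F 0 (of_real y)) (at_right 0)"
    unfolding F_def by (intro tendsto_intros gaussian_tower_tendsto)
  ultimately have "((\<lambda>\<tau>. F \<tau> (of_real y) - (\<Sum>k. (- 1) ^ k * E \<tau> k)) \<longlongrightarrow> F 0 (of_real y) - (\<Sum>k. 0)) (at_right 0)"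
    by (intro tendsto_diff)
  also have "F 0 (of_real y) - (\<Sum>k::nat. 0) = half_euler_poly p y"
    unfolding F_def
    by (simp add: gaussian_tower_at_0 del: gaussian_tower.simps, rule half_euler_poly_eq)
       (auto simp: N_def prod_falling_zero)
  finally show ?thesis
    by (rule Lim_transform_eventually)
       (use alternating_gaussian_eq[OF y N_def] in
         \<open>auto simp: F_def E_def sums_iff simp del: gaussian_tower.simps intro!: eventually_mono[OF eventually_at_right_less[of 0]]\<close>)
qed

section \<open>Values of the L-function and radial limits of the series\<close>

lemma ecis_eq_cis: "ecis x = cis (2 * pi * x)"
  by (simp add: ecis_def cis_conv_exp algebra_simps)

lemma ecis_add: "ecis (x + y) = ecis x * ecis y"
  by (simp add: ecis_eq_cis cis_mult algebra_simps)

lemma ecis_of_int [simp]: "ecis (of_int m) = 1"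
  using cis_multiple_2pi[of "of_int m"] by (simp add: ecis_eq_cis)

lemma ecis_power: "ecis x ^ n = ecis (of_nat n * x)"
  unfolding ecis_eq_cis Complex.DeMoivre by (simp add: mult_ac)

lemma norm_ecis [simp]: "norm (ecis x) = 1"
  by (simp add: ecis_eq_cis)

lemma ecis_half_odd: "odd m \<Longrightarrow> ecis (of_int m / 2) = - 1"
proof -
  assume "odd m"
  then obtain w where w: "m = 2 * w + 1"
    by (rule oddE)
  have "of_int m / 2 = of_int w + (1 / 2 :: real)"
    unfolding w by (simp add: add_divide_distrib)
  thus ?thesis
    by (simp only: ecis_add ecis_of_int) (simp add: ecis_eq_cis)
qed

lemma odd_of_coprime_even:
  assumes "even h" "coprime u (int h)"
  shows "odd u"
  using assms coprime_common_divisor[of u "int h" 2] by auto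

definition theta_coeff :: "nat \<Rightarrow> int \<Rightarrow> nat \<Rightarrow> complex" where
  "theta_coeff h u k = ecis (of_int (u * tri (int k)) / of_nat h)"

lemma tri_of_nat: "tri (int k) = int (tri k)"
  by (simp add: tri_def zdiv_int algebra_simps)

lemma two_times_tri: "2 * tri (k::nat) = k * (k + 1)"
  by (simp add: tri_def)

lemma two_times_tri_int: "2 * tri (k::int) = k * (k + 1)"
  by (simp add: tri_def)

lemma eight_times_tri: "8 * of_nat (tri k) = (of_nat (2 * k + 1))\<^sup>2 - (1 :: real)"
proof -
  have "8 * tri k + 1 = (2 * k + 1)\<^sup>2"
    using two_times_tri[of k] by (simp add: power2_eq_square algebra_simps)
  hence "of_nat (8 * tri k + 1) = (of_nat ((2 * k + 1)\<^sup>2) :: real)"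
    by (rule arg_cong)
  thus ?thesis
    by simp
qed

text \<open>
  \<open>T\<^sub>k\<^sub>+\<^sub>h = T\<^sub>k + h k + (h/2) (h + 1)\<close>, and \<open>u (h + 1)\<close> is odd, so the shift contributes the factor
  \<open>e(u (h + 1)/2) = -1\<close>. This sign is what makes all sums below alternating.
\<close>

lemma theta_coeff_add_period:
  assumes "h > 0" "even h" "odd u"
  shows "theta_coeff h u (k + h) = - theta_coeff h u k"
proof -
  obtain m where m: "h = 2 * m" using assms(2) by (rule evenE)
  have "2 * tri (int (k + h)) = 2 * (tri (int k) + int h * int k + int m * (int h + 1))"
    unfolding distrib_left two_times_tri_int by (simp add: m algebra_simps)
  hence "tri (int (k + h)) = tri (int k) + int h * int k + int m * (int h + 1)"
    by (simp only: mult_cancel_left) simp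
  hence "u * tri (int (k + h)) = u * tri (int k) + int h * (u * int k) + int m * (u * (int h + 1))"
    by (simp only:) (simp add: algebra_simps)
  hence "of_int (u * tri (int (k + h))) / of_nat h
      = of_int (u * tri (int k)) / of_nat h + of_int (u * int k) + (of_int (u * (int h + 1)) / 2 :: real)"
    using assms(1) by (simp add: m field_simps)
  moreover have "ecis (of_int (u * (int h + 1)) / 2) = - 1"
    by (rule ecis_half_odd) (use assms in simp)
  ultimately show ?thesis
    unfolding theta_coeff_def by (simp only: ecis_add ecis_of_int) simp
qed

lemma theta_coeff_add_periods:
  assumes "h > 0" "even h" "odd u"
  shows "theta_coeff h u (k + i * h) = (- 1) ^ i * theta_coeff h u k"
proof (induction i)
  case (Suc i)
  have "theta_coeff h u (k + Suc i * h) = theta_coeff h u ((k + i * h) + h)"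
    by (simp add: add_ac)
  thus ?case
    by (simp only: theta_coeff_add_period[OF assms] Suc) simp
qed simp

text \<open>
  The common value of the continued \<open>L\<close>-function at \<open>-p\<close> and of the radial limit of the series,
  as an explicit finite sum.
\<close>

definition theta_value :: "nat \<Rightarrow> nat \<Rightarrow> int \<Rightarrow> complex" where
  "theta_value p h u = of_nat (2 * h) ^ p *
     (\<Sum>j<h. theta_coeff h u j * half_euler_poly p (of_nat (2 * j + 1) / of_nat (2 * h)))"

lemma sum_odd_indices:
  fixes g :: "nat \<Rightarrow> 'a :: comm_monoid_add"
  assumes "\<And>r. even r \<Longrightarrow> g r = 0"
  shows "(\<Sum>r = 1..2 * M. g r) = (\<Sum>k<M. g (2 * k + 1))"
proof (induction M)
  case (Suc M)
  have "{1..2 * Suc M} = insert (2 * M + 2) (insert (2 * M + 1) {1..2 * M})"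
    by auto
  thus ?case
    using Suc assms[of "2 * M + 2"] by (simp add: add.commute)
qed simp

lemma sum_two_periods: "(\<Sum>k<2 * h. f k) = (\<Sum>k<h. f k + f (k + h) :: 'a :: comm_monoid_add)" for h :: nat
proof -
  have "(\<Sum>k<2 * h. f k) = (\<Sum>k\<in>{0..<h}. f k) + (\<Sum>k\<in>{0 + h..<h + h}. f k)"
    using sum.atLeastLessThan_concat[of 0 h "2 * h" f] by (simp add: lessThan_atLeast0 mult_2)
  also have "(\<Sum>k\<in>{0 + h..<h + h}. f k) = (\<Sum>k\<in>{0..<h}. f (k + h))"
    by (rule sum.shift_bounds_nat_ivl)
  finally show ?thesis
    by (simp add: sum.distrib lessThan_atLeast0)
qed

text \<open>
  Only odd residues contribute, and those in the second half of a period \<open>4h\<close> repeat those of the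
  first half with the opposite sign. So the Hurwitz zeta functions occur in differences at \<open>y/2\<close> and
  \<open>(y + 1)/2\<close> with \<open>y = (2j + 1)/(2h)\<close>.
\<close>

lemma L_b_neg_nat:
  assumes "h > 0" "even h" "odd u"
  shows "L_b h u (- of_nat p) = theta_value p h u"
proof -
  define y where "y = (\<lambda>k. of_nat (2 * k + 1) / of_nat (2 * h) :: real)"
  have "L_b h u (- of_nat p) = of_nat (4 * h) ^ p *
     (\<Sum>r = 1..2 * (2 * h). bseq h u (int r) * hurwitz_zeta (real r / real (4 * h)) (- of_nat p))"
    using assms(1) by (simp add: L_b_def)
  also have "(\<Sum>r = 1..2 * (2 * h). bseq h u (int r) * hurwitz_zeta (real r / real (4 * h)) (- of_nat p))
      = (\<Sum>k<2 * h. theta_coeff h u k * hurwitz_zeta (y k / 2) (- of_nat p))"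
  proof (subst sum_odd_indices)
    have "bseq h u (int (2 * k + 1)) = theta_coeff h u k" for k
      using bseq_odd[of h u "int k"] by (simp add: theta_coeff_def add.commute)
    thus "(\<Sum>k<2 * h. bseq h u (int (2 * k + 1)) * hurwitz_zeta (real (2 * k + 1) / real (4 * h)) (- of_nat p))
      = (\<Sum>k<2 * h. theta_coeff h u k * hurwitz_zeta (y k / 2) (- of_nat p))"
      by (simp add: y_def)
  qed (simp add: bseq_def)
  also have "\<dots> = (\<Sum>k<h. theta_coeff h u k * (hurwitz_zeta (y k / 2) (- of_nat p) - hurwitz_zeta ((y k + 1) / 2) (- of_nat p)))"
  proof -
    have "y (k + h) = y k + 1" for k
      using assms(1) by (simp add: y_def field_simps)
    thus ?thesis
      by (simp add: sum_two_periods theta_coeff_add_period[OF assms] right_diff_distrib)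
  qed
  also have "\<dots> = (\<Sum>k<h. theta_coeff h u k * (half_euler_poly p (y k) / 2 ^ p))"
    using assms(1) by (intro sum.cong refl) (subst hurwitz_zeta_diff_neg_nat, auto simp: y_def)
  also have "of_nat (4 * h) ^ p * \<dots> = of_nat (2 * h) ^ p * (\<Sum>k<h. theta_coeff h u k * half_euler_poly p (y k))"
  proof -
    have "(of_nat (4 * h) :: complex) = 2 * of_nat (2 * h)"
      by simp
    hence "(of_nat (4 * h) :: complex) ^ p = of_nat (2 * h) ^ p * 2 ^ p"
      by (simp only: power_mult_distrib mult.commute)
    moreover have "(\<Sum>k<h. theta_coeff h u k * (half_euler_poly p (y k) / 2 ^ p))
        = (\<Sum>k<h. theta_coeff h u k * half_euler_poly p (y k)) / 2 ^ p"
      by (simp add: sum_divide_distrib)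
    ultimately show ?thesis
      by (simp only:) simp
  qed
  finally show ?thesis
    by (simp add: theta_value_def y_def)
qed

lemma summable_odd_gaussian:
  assumes "\<tau> > 0"
  shows "summable (\<lambda>k. of_nat (2 * k + 1) ^ p * exp (- (\<tau> * (of_nat (2 * k + 1))\<^sup>2)) :: real)"
proof (rule summable_comparison_test_ev)
  have "norm (of_nat (2 * k + 1) ^ p * exp (- (\<tau> * (of_nat (2 * k + 1))\<^sup>2)) :: real) \<le>
      (fact (p + 1) / \<tau> ^ (p + 1)) * of_nat k powr (- 2)" if k: "k \<ge> 1" for k
  proof -
    define x where "x = real (2 * k + 1)"
    have x: "x \<ge> real k" "x \<ge> 1" by (auto simp: x_def)
    have "gaussian_tower 0 (p + 1) p \<tau> (of_real x) = of_real (\<tau> ^ (p + 1) * (x ^ p * exp (- (\<tau> * x\<^sup>2))))"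
      by (simp add: exp_of_real[symmetric])
    hence "\<tau> ^ (p + 1) * (x ^ p * exp (- (\<tau> * x\<^sup>2))) = norm (gaussian_tower 0 (p + 1) p \<tau> (of_real x))"
      using assms x by (simp only: norm_of_real) simp
    also have "\<dots> \<le> fact (p + 1) * x powr (of_nat p - 2 * of_nat (p + 1))"
      using assms x by (intro norm_gaussian_tower_0_le) auto
    also have "\<dots> \<le> fact (p + 1) * x powr (- 2)"
      using x by (intro mult_left_mono powr_mono) auto
    also have "\<dots> \<le> fact (p + 1) * of_nat k powr (- 2)"
      using x k by (intro mult_left_mono powr_mono2') auto
    finally have "x ^ p * exp (- (\<tau> * x\<^sup>2)) \<le> fact (p + 1) * of_nat k powr (- 2) / \<tau> ^ (p + 1)"
      using assms by (simp add: pos_le_divide_eq mult.commute del: power_Suc)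
    thus ?thesis
      using x by (simp add: x_def)
  qed
  thus "\<forall>\<^sub>F k in sequentially. norm (of_nat (2 * k + 1) ^ p * exp (- (\<tau> * (of_nat (2 * k + 1))\<^sup>2)) :: real) \<le>
      (fact (p + 1) / \<tau> ^ (p + 1)) * of_nat k powr (- 2)"
    by (intro eventually_mono[OF eventually_ge_at_top[of 1]])
  show "summable (\<lambda>k. (fact (p + 1) / \<tau> ^ (p + 1)) * of_nat k powr (- 2))"
    by (intro summable_mult) (simp add: summable_real_powr_iff)
qed

text \<open>
  Collecting the indices \<open>k = j + i h\<close> with \<open>j < h\<close> fixed, the sign \<open>(-1)^i\<close> comes from
  antiperiodicity and \<open>2k + 1 = 2h (i + y\<^sub>j)\<close>, so each class is a damped alternating power sum with
  parameter \<open>\<tau> = t h\<^sup>2/2\<close>. The factor \<open>exp (t/8)\<close> is the constant in \<open>8 T\<^sub>k = (2k + 1)\<^sup>2 - 1\<close>.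
\<close>

lemma N_series_tendsto:
  assumes h: "h > 0" "even h" "odd u"
  shows "((\<lambda>t::real. N_series n (- ecis (of_int u / of_nat h) * of_real (exp (- t))))
           \<longlongrightarrow> theta_value (2 * n + 1) h u) (at_right 0)"
proof -
  define p where "p = 2 * n + 1"
  define y where "y = (\<lambda>j. of_nat (2 * j + 1) / of_nat (2 * h) :: real)"
  define G where "G = (\<lambda>j \<tau>. \<Sum>k. (- 1) ^ k *
      complex_of_real ((of_nat k + y j) ^ p * exp (- (\<tau> * (of_nat k + y j)\<^sup>2))))"
  define R where "R = (\<lambda>t. of_real (exp (t / 8)) *
      (of_nat (2 * h) ^ p * (\<Sum>j<h. theta_coeff h u j * G j (t * of_nat h ^ 2 / 2))))"
  have y: "y j > 0" for j
    using h by (simp add: y_def)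
  have N_eq: "N_series n (- ecis (of_int u / of_nat h) * of_real (exp (- t))) = R t" if t: "t > 0" for t
  proof -
    define a where "a = (\<lambda>k. theta_coeff h u k * of_real (exp (t / 8)) *
        complex_of_real (of_nat (2 * k + 1) ^ p * exp (- (t / 8 * (of_nat (2 * k + 1))\<^sup>2))))"
    have "(- 1) ^ tri k * of_nat (2 * k + 1) ^ (2 * n + 1) *
        (- ecis (of_int u / of_nat h) * of_real (exp (- t))) ^ tri k = a k" for k
    proof -
      have "(- 1) ^ tri k * (- ecis (of_int u / of_nat h) * of_real (exp (- t))) ^ tri k
          = (ecis (of_int u / of_nat h) ^ tri k) * of_real (exp (- t) ^ tri k)"
        by (simp only: power_mult_distrib[symmetric]) (simp add: power_mult_distrib)
      also have "ecis (of_int u / of_nat h) ^ tri k = theta_coeff h u k"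
        by (simp add: ecis_power theta_coeff_def tri_of_nat mult.commute)
      also have "exp (- t) ^ tri k = exp (t / 8) * exp (- (t / 8 * (of_nat (2 * k + 1))\<^sup>2))"
      proof -
        have "of_nat (tri k) * (- t) = t / 8 - t / 8 * (8 * of_nat (tri k) + 1)"
          by (simp add: algebra_simps)
        also have "8 * real (tri k) + 1 = (of_nat (2 * k + 1))\<^sup>2"
          using eight_times_tri[of k] by simp
        finally show ?thesis
          by (simp add: exp_of_nat_mult[symmetric] exp_add[symmetric])
      qed
      finally have "(- 1) ^ tri k * (- ecis (of_int u / of_nat h) * of_real (exp (- t))) ^ tri k = theta_coeff h u k *
          of_real (exp (t / 8) * exp (- (t / 8 * (of_nat (2 * k + 1))\<^sup>2)))" .
      hence "of_nat (2 * k + 1) ^ p * ((- 1) ^ tri k * (- ecis (of_int u / of_nat h) * of_real (exp (- t))) ^ tri k)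
          = of_nat (2 * k + 1) ^ p * (theta_coeff h u k *
          of_real (exp (t / 8) * exp (- (t / 8 * (of_nat (2 * k + 1))\<^sup>2))))"
        by (rule arg_cong)
      thus ?thesis
        unfolding a_def p_def of_real_mult of_real_power of_real_of_nat_eq by (simp only: mult_ac)
    qed
    hence "N_series n (- ecis (of_int u / of_nat h) * of_real (exp (- t))) = (\<Sum>k. a k)"
      by (simp add: N_series_def)
    also have "\<dots> = R t"
    proof -
      have "summable a"
      proof (rule summable_norm_cancel)
        have "norm (a k) = exp (t / 8) * (of_nat (2 * k + 1) ^ p * exp (- (t / 8 * (of_nat (2 * k + 1))\<^sup>2)))" for k
          by (simp add: a_def norm_mult theta_coeff_def norm_power del: of_real_mult of_real_power of_real_exp of_nat_Suc of_nat_add)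
        thus "summable (\<lambda>k. norm (a k))"
          using t by (simp only: ) (intro summable_mult summable_odd_gaussian, simp)
      qed
      hence "(\<lambda>i. sum a {i * h..<i * h + h}) sums (\<Sum>k. a k)"
        using h by (intro sums_group summable_sums)
      moreover have "sum a {i * h..<i * h + h} = of_real (exp (t / 8)) * (of_nat (2 * h) ^ p *
          (\<Sum>j<h. theta_coeff h u j * ((- 1) ^ i *
            complex_of_real ((of_nat i + y j) ^ p * exp (- (t * of_nat h ^ 2 / 2 * (of_nat i + y j)\<^sup>2))))))" for i
      proof -
        have "sum a {i * h..<i * h + h} = (\<Sum>j<h. a (j + i * h))"
          using sum.shift_bounds_nat_ivl[of a 0 "i * h" h] by (simp add: add.commute lessThan_atLeast0)
        also have "\<dots> = (\<Sum>j<h. of_real (exp (t / 8)) * (of_nat (2 * h) ^ p *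
          (theta_coeff h u j * ((- 1) ^ i *
            complex_of_real ((of_nat i + y j) ^ p * exp (- (t * of_nat h ^ 2 / 2 * (of_nat i + y j)\<^sup>2)))))))"
        proof (rule sum.cong)
          fix j
          have eq: "real (2 * (j + i * h) + 1) = of_nat (2 * h) * (of_nat i + y j)"
            using h by (simp add: y_def field_simps)
          have "t / 8 * (of_nat (2 * h) * (of_nat i + y j))\<^sup>2 = t * of_nat h ^ 2 / 2 * (of_nat i + y j)\<^sup>2"
            by (simp add: power_mult_distrib)
          thus "a (j + i * h) = of_real (exp (t / 8)) * (of_nat (2 * h) ^ p *
          (theta_coeff h u j * ((- 1) ^ i *
            complex_of_real ((of_nat i + y j) ^ p * exp (- (t * of_nat h ^ 2 / 2 * (of_nat i + y j)\<^sup>2))))))"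
            unfolding a_def eq theta_coeff_add_periods[OF h]
            by (simp only: power_mult_distrib[where n = p] of_real_mult of_real_power of_real_of_nat_eq mult_ac)
        qed simp
        finally show ?thesis
          by (simp add: sum_distrib_left)
      qed
      ultimately have "(\<lambda>i. of_real (exp (t / 8)) * (of_nat (2 * h) ^ p *
          (\<Sum>j<h. theta_coeff h u j * ((- 1) ^ i *
            complex_of_real ((of_nat i + y j) ^ p * exp (- (t * of_nat h ^ 2 / 2 * (of_nat i + y j)\<^sup>2)))))))
          sums (\<Sum>k. a k)"
        by simp
      moreover have "(\<lambda>i. of_real (exp (t / 8)) * (of_nat (2 * h) ^ p *
          (\<Sum>j<h. theta_coeff h u j * ((- 1) ^ i *
            complex_of_real ((of_nat i + y j) ^ p * exp (- (t * of_nat h ^ 2 / 2 * (of_nat i + y j)\<^sup>2)))))))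
          sums R t"
        unfolding R_def G_def
        using t h by (intro sums_mult sums_sum summable_sums sums_summable[OF alternating_gaussian_eq[OF y refl]]) simp
      ultimately show ?thesis
        by (rule sums_unique2)
    qed
    finally show ?thesis .
  qed
  have "(R \<longlongrightarrow> of_real (exp (0 / 8)) * (of_nat (2 * h) ^ p * (\<Sum>j<h. theta_coeff h u j * half_euler_poly p (y j)))) (at_right 0)"
    unfolding R_def
  proof (intro tendsto_intros)
    fix j
    have "filterlim (\<lambda>t. t * of_nat h ^ 2 / 2 :: real) (at_right 0) (at_right 0)"
    proof (rule tendsto_imp_filterlim_at_right)
      have "((\<lambda>t. t * of_nat h ^ 2 / 2 :: real) \<longlongrightarrow> 0 * of_nat h ^ 2 / 2) (at_right 0)"
        by (intro tendsto_intros) auto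
      thus "((\<lambda>t. t * of_nat h ^ 2 / 2 :: real) \<longlongrightarrow> 0) (at_right 0)"
        by simp
      show "\<forall>\<^sub>F t in at_right 0. t * of_nat h ^ 2 / 2 > (0 :: real)"
        using h by (auto intro!: eventually_mono[OF eventually_at_right_less[of 0]])
    qed
    thus "((\<lambda>t. G j (t * of_nat h ^ 2 / 2)) \<longlongrightarrow> half_euler_poly p (y j)) (at_right 0)"
      unfolding G_def by (rule filterlim_compose[OF alternating_gaussian_limit[OF y]])
  qed auto
  hence "(R \<longlongrightarrow> theta_value p h u) (at_right 0)"
    by (simp add: theta_value_def y_def)
  thus ?thesis
    unfolding p_def
    by (rule Lim_transform_eventually)
       (use N_eq in \<open>auto intro!: eventually_mono[OF eventually_at_right_less[of 0]]\<close>)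
qed

section \<open>Nonvanishing of the L-function at -1\<close>

lemma half_euler_poly_1: "half_euler_poly 1 y = of_real y / 2 - 1 / 4"
proof -
  have e0: "fps_nth euler_coeffs 0 = 1 / 2"
    using euler_coeffs_rec[of 0] by (simp add: field_simps)
  have "2 * fps_nth euler_coeffs 1 = - (1 / 2)"
    using euler_coeffs_rec[of 1] e0 by simp
  hence e1: "fps_nth euler_coeffs 1 = - 1 / 4"
    by (simp add: field_simps)
  show ?thesis
    using e0 e1 by (simp add: half_euler_poly_def)
qed

text \<open>One half of the first Euler polynomial is \<open>y/2 - 1/4\<close>, so the weights form a sawtooth.\<close>

lemma theta_value_1:
  assumes "h > 0"
  shows "2 * theta_value 1 h u = (\<Sum>k<h. theta_coeff h u k * (2 * of_nat k + 1 - of_nat h))"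
proof -
  have "4 * of_nat h * half_euler_poly 1 (of_nat (2 * k + 1) / of_nat (2 * h))
      = 2 * of_nat k + 1 - of_nat h" for k
    using assms unfolding half_euler_poly_1 by (simp add: field_simps)
  moreover have "2 * theta_value 1 h u = (\<Sum>k<h. theta_coeff h u k *
      (4 * of_nat h * half_euler_poly 1 (of_nat (2 * k + 1) / of_nat (2 * h))))"
    by (simp add: theta_value_def sum_distrib_left algebra_simps)
  ultimately show ?thesis
    by (simp only:)
qed

lemma ecis_eq_1_iff: "ecis x = 1 \<longleftrightarrow> x \<in> \<int>"
proof -
  have "ecis x = 1 \<longleftrightarrow> (\<exists>n::int. 2 * pi * x = of_int (2 * n) * pi)"
    by (simp add: ecis_def exp_eq_1)
  also have "\<dots> \<longleftrightarrow> (\<exists>n::int. x = of_int n)"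
    by (simp add: mult_ac)
  finally show ?thesis
    by (simp add: Ints_def image_iff)
qed

lemma sum_ecis_multiples:
  assumes "h > 0"
  shows "(\<Sum>l<h. ecis (of_nat l * (of_int d / of_nat h))) = (if int h dvd d then of_nat h else 0)"
proof -
  define x where "x = ecis (of_int d / of_nat h)"
  have x_iff: "x = 1 \<longleftrightarrow> int h dvd d"
  proof -
    have "of_int d / of_nat h \<in> (\<int> :: real set) \<longleftrightarrow> int h dvd d"
      using assms of_int_div_of_int_in_Ints_iff[of d "int h", where ?'a = real] by simp
    thus ?thesis
      by (simp add: x_def ecis_eq_1_iff)
  qed
  have "x ^ h = 1"
    using assms by (simp add: x_def ecis_power)
  have "(\<Sum>l<h. ecis (of_nat l * (of_int d / of_nat h))) = (\<Sum>l<h. x ^ l)"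
    by (simp add: x_def ecis_power)
  also have "\<dots> = (if x = 1 then of_nat h else 0)"
    using \<open>x ^ h = 1\<close> by (simp add: geometric_sum)
  finally show ?thesis
    by (simp add: x_iff)
qed

lemma sum_shift_periodic:
  fixes f :: "nat \<Rightarrow> 'a :: ab_group_add"
  assumes "\<And>k. f (k + h) = f k"
  shows "(\<Sum>k<h. f (k + d)) = (\<Sum>k<h. f k)"
proof (induction d)
  case (Suc d)
  have "(\<Sum>k<h. f (Suc k + d)) + f d = (\<Sum>k<Suc h. f (k + d))"
    by (simp only: sum.lessThan_Suc_shift) (simp add: add.commute)
  also have "\<dots> = (\<Sum>k<h. f (k + d)) + f d"
    using assms[of d] by (simp add: add.commute)
  finally show ?case
    using Suc by simp
qed simp

text \<open>
  Half of the Fourier coefficient of \<open>b\<close>, over its period \<open>4h\<close>, at the odd frequency \<open>2l + 1\<close>: by the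
  sign change under the shift by \<open>2h\<close>, the two halves of the period contribute equally at odd
  frequencies and cancel at even ones.
\<close>

definition gauss_sum :: "nat \<Rightarrow> int \<Rightarrow> nat \<Rightarrow> complex" where
  "gauss_sum h u l = (\<Sum>k<h. theta_coeff h u k * ecis (- (of_nat ((2 * l + 1) * (2 * k + 1)) / of_nat (4 * h))))"

lemma tri_add_int: "tri (a + b) = tri a + a * b + tri (b :: int)"
proof -
  have "2 * tri (a + b) = 2 * (tri a + a * b + tri b)"
    unfolding distrib_left two_times_tri_int by (simp add: algebra_simps)
  thus ?thesis by simp
qed

text \<open>
  The summand \<open>c k\<close> has period \<open>h\<close>, and \<open>c (k + d)\<close> times the conjugate of \<open>c k\<close> is a constant times
  \<open>e(u d k/h)\<close> because \<open>T\<^sub>k\<^sub>+\<^sub>d - T\<^sub>k\<close> is affine in \<open>k\<close>. Summing over \<open>k\<close> annihilates every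
  \<open>d \<noteq> 0\<close>, and \<open>d = 0\<close> contributes \<open>h\<close>.
\<close>

lemma norm_gauss_sum:
  assumes h: "h > 0" "even h" and u: "coprime u (int h)"
  shows "norm (gauss_sum h u l) = sqrt (of_nat h)"
proof -
  have "odd u"
    using h(2) u by (rule odd_of_coprime_even)
  define c where "c = (\<lambda>k. theta_coeff h u k * ecis (- (of_nat ((2 * l + 1) * (2 * k + 1)) / of_nat (4 * h))))"
  have c_period: "c (k + h) = c k" for k
  proof -
    have "- (of_nat ((2 * l + 1) * (2 * (k + h) + 1)) / of_nat (4 * h))
        = - (of_nat ((2 * l + 1) * (2 * k + 1)) / of_nat (4 * h)) + (of_int (- (2 * int l + 1)) / 2 :: real)"
      using h by (simp add: field_simps)
    moreover have "ecis (of_int (- (2 * int l + 1)) / 2) = - 1"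
      by (rule ecis_half_odd) simp
    ultimately show ?thesis
      unfolding c_def theta_coeff_add_period[OF h \<open>odd u\<close>] by (simp only: ecis_add) simp
  qed
  have corr: "(\<Sum>k<h. c (k + d) * cnj (c k)) = (if d = 0 then of_nat h else 0)" if "d < h" for d
  proof -
    define A where "A = ecis (of_int (u * tri (int d)) / of_nat h - of_nat ((2 * l + 1) * d) / of_nat (2 * h))"
    have "c (k + d) * cnj (c k) = A * ecis (of_nat k * (of_int (u * int d) / of_nat h))" for k
    proof -
      have "c (k + d) * cnj (c k) = ecis (of_int (u * tri (int k + int d)) / of_nat h
          + - (of_nat ((2 * l + 1) * (2 * (k + d) + 1)) / of_nat (4 * h))
          + (- (of_int (u * tri (int k)) / of_nat h) + of_nat ((2 * l + 1) * (2 * k + 1)) / of_nat (4 * h)))"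
        unfolding ecis_add c_def theta_coeff_def by (simp add: ecis_eq_cis cis_cnj)
      also have "of_int (u * tri (int k + int d)) / of_nat h
          + - (of_nat ((2 * l + 1) * (2 * (k + d) + 1)) / of_nat (4 * h))
          + (- (of_int (u * tri (int k)) / of_nat h) + of_nat ((2 * l + 1) * (2 * k + 1)) / of_nat (4 * h))
          = (of_int (u * tri (int d)) / of_nat h - of_nat ((2 * l + 1) * d) / of_nat (2 * h))
            + (of_nat k * (of_int (u * int d) / of_nat h) :: real)"
        using h unfolding tri_add_int by (simp add: field_simps)
      finally show ?thesis
        unfolding A_def by (simp only: ecis_add)
    qed
    hence "(\<Sum>k<h. c (k + d) * cnj (c k)) = A * (\<Sum>k<h. ecis (of_nat k * (of_int (u * int d) / of_nat h)))"
      by (simp only: sum_distrib_left)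
    also have "\<dots> = A * (if int h dvd u * int d then of_nat h else 0)"
      using sum_ecis_multiples[OF h(1), of "u * int d"] by (simp only:)
    also have "int h dvd u * int d \<longleftrightarrow> int h dvd int d"
      using u by (simp add: coprime_commute coprime_dvd_mult_right_iff)
    also have "\<dots> \<longleftrightarrow> d = 0"
      using that by (auto dest: dvd_imp_le)
    also have "A * (if d = 0 then of_nat h else 0) = (if d = 0 then of_nat h else 0)"
      by (simp add: A_def tri_def ecis_eq_cis)
    finally show ?thesis .
  qed
  have sum_eq: "gauss_sum h u l = (\<Sum>k<h. c k)"
    by (simp add: gauss_sum_def c_def)
  have "gauss_sum h u l * cnj (gauss_sum h u l) = (\<Sum>k'<h. \<Sum>k<h. c k * cnj (c k'))"
    unfolding sum_eq cnj_sum sum_product by (rule sum.swap)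
  also have "\<dots> = (\<Sum>k'<h. \<Sum>d<h. c (k' + d) * cnj (c k'))"
  proof (rule sum.cong)
    fix k'
    show "(\<Sum>k<h. c k * cnj (c k')) = (\<Sum>d<h. c (k' + d) * cnj (c k'))"
      using sum_shift_periodic[of "\<lambda>k. c k * cnj (c k')" h k'] c_period by (simp add: add.commute)
  qed simp
  also have "\<dots> = (\<Sum>d<h. \<Sum>k'<h. c (k' + d) * cnj (c k'))"
    by (rule sum.swap)
  also have "\<dots> = (\<Sum>d<h. if d = 0 then of_nat h else 0)"
    by (intro sum.cong corr) auto
  also have "\<dots> = of_nat h"
    using h by simp
  finally have "complex_of_real ((norm (gauss_sum h u l))\<^sup>2) = of_real (of_nat h)"
    by (simp only: complex_norm_square) simp
  hence "(norm (gauss_sum h u l))\<^sup>2 = of_nat h"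
    by (simp only: of_real_eq_iff)
  thus ?thesis
    by (metis norm_ge_zero real_sqrt_unique)
qed

text \<open>
  The index \<open>l = h - 1\<close> is the frequency \<open>2h - 1\<close>, the mirror image of the lowest frequency \<open>1\<close>. The
  substitution \<open>k \<mapsto> h - 1 - k\<close> exchanges the two and turns every \<open>\<beta>\<^sub>k\<close> into \<open>-\<beta>\<^sub>k\<close>.
\<close>

lemma gauss_sum_reflect:
  assumes h: "h > 0" "even h" and u: "odd u"
  shows "gauss_sum h u (h - 1) = - gauss_sum h u 0"
proof -
  have refl: "theta_coeff h u (h - Suc k) = - theta_coeff h u k" if "k < h" for k
  proof -
    obtain m where m: "h = 2 * m" using h(2) by (rule evenE)
    have k: "int (h - Suc k) = int h + (- int k - 1)"
      using that by simp
    have "tri (- int k - 1) = tri (int k)"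
      by (simp add: tri_def algebra_simps)
    hence "tri (int (h - Suc k)) = tri (int h) + int h * (- int k - 1) + tri (int k)"
      unfolding k tri_add_int by simp
    moreover have "tri (int h) = int m * (int h + 1)"
      by (simp add: tri_def m)
    ultimately have eq: "u * tri (int (h - Suc k))
        = u * tri (int k) + int h * (u * (- int k - 1)) + int m * (u * (int h + 1))"
      by (simp only:) (simp add: algebra_simps)
    have "of_int (u * tri (int (h - Suc k))) / of_nat h
      = of_int (u * tri (int k)) / of_nat h + of_int (u * (- int k - 1)) + (of_int (u * (int h + 1)) / 2 :: real)"
      unfolding eq using h(1) by (simp add: m field_simps)
    moreover have "ecis (of_int (u * (int h + 1)) / 2) = - 1"
      by (rule ecis_half_odd) (use h u in simp)
    ultimately show ?thesis
      unfolding theta_coeff_def by (simp only: ecis_add ecis_of_int) simp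
  qed
  have "gauss_sum h u (h - 1) = (\<Sum>k<h. theta_coeff h u (h - Suc k) *
      ecis (- (of_nat ((2 * (h - 1) + 1) * (2 * (h - Suc k) + 1)) / of_nat (4 * h))))"
    unfolding gauss_sum_def by (rule sum.nat_diff_reindex[symmetric])
  also have "\<dots> = (\<Sum>k<h. - (theta_coeff h u k * ecis (- (of_nat ((2 * 0 + 1) * (2 * k + 1)) / of_nat (4 * h)))))"
  proof (rule sum.cong)
    fix k assume "k \<in> {..<h}"
    hence k: "k < h" by simp
    have "- (of_nat ((2 * (h - 1) + 1) * (2 * (h - Suc k) + 1)) / of_nat (4 * h))
        = of_int (int k + 1 - int h) + - (of_nat ((2 * 0 + 1) * (2 * k + 1)) / of_nat (4 * h) :: real)"
      using h k by (simp add: of_nat_diff field_simps)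
    thus "theta_coeff h u (h - Suc k) *
      ecis (- (of_nat ((2 * (h - 1) + 1) * (2 * (h - Suc k) + 1)) / of_nat (4 * h)))
      = - (theta_coeff h u k * ecis (- (of_nat ((2 * 0 + 1) * (2 * k + 1)) / of_nat (4 * h))))"
      by (simp only: ecis_add ecis_of_int refl[OF k]) simp
  qed simp
  finally show ?thesis
    by (simp add: gauss_sum_def sum_negf)
qed

lemma theta_coeff_gauss_inversion:
  assumes h: "h > 0" and k: "k < h"
  shows "(\<Sum>l<h. gauss_sum h u l * ecis (of_nat ((2 * l + 1) * (2 * k + 1)) / of_nat (4 * h)))
           = of_nat h * theta_coeff h u k"
proof -
  have "(\<Sum>l<h. gauss_sum h u l * ecis (of_nat ((2 * l + 1) * (2 * k + 1)) / of_nat (4 * h)))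
      = (\<Sum>l<h. \<Sum>k'<h. theta_coeff h u k' * ecis ((of_int (int k - int k')) / of_nat (2 * h)) *
           ecis (of_nat l * (of_int (int k - int k') / of_nat h)))"
    unfolding gauss_sum_def sum_distrib_right
  proof (intro sum.cong refl)
    fix l k'
    have "- (of_nat ((2 * l + 1) * (2 * k' + 1)) / of_nat (4 * h)) + of_nat ((2 * l + 1) * (2 * k + 1)) / of_nat (4 * h)
        = (of_int (int k - int k')) / of_nat (2 * h) + (of_nat l * (of_int (int k - int k') / of_nat h) :: real)"
      using h by (simp add: field_simps)
    thus "theta_coeff h u k' * ecis (- (of_nat ((2 * l + 1) * (2 * k' + 1)) / of_nat (4 * h))) *
          ecis (of_nat ((2 * l + 1) * (2 * k + 1)) / of_nat (4 * h))
        = theta_coeff h u k' * ecis ((of_int (int k - int k')) / of_nat (2 * h)) *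
           ecis (of_nat l * (of_int (int k - int k') / of_nat h))"
      by (simp only: mult.assoc ecis_add[symmetric])
  qed
  also have "\<dots> = (\<Sum>k'<h. theta_coeff h u k' * ecis ((of_int (int k - int k')) / of_nat (2 * h)) *
           (\<Sum>l<h. ecis (of_nat l * (of_int (int k - int k') / of_nat h))))"
    unfolding sum_distrib_left by (rule sum.swap)
  also have "\<dots> = (\<Sum>k'<h. if k' = k then of_nat h * theta_coeff h u k else 0)"
  proof (intro sum.cong refl)
    fix k' assume "k' \<in> {..<h}"
    hence "int h dvd int k - int k' \<longleftrightarrow> k' = k"
      using k dvd_imp_le_int[of "int k - int k'" "int h"] by fastforce
    thus "theta_coeff h u k' * ecis ((of_int (int k - int k')) / of_nat (2 * h)) *
           (\<Sum>l<h. ecis (of_nat l * (of_int (int k - int k') / of_nat h)))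
        = (if k' = k then of_nat h * theta_coeff h u k else 0)"
      unfolding sum_ecis_multiples[OF h] by (simp add: ecis_eq_cis)
  qed
  also have "\<dots> = of_nat h * theta_coeff h u k"
    using k by simp
  finally show ?thesis .
qed

lemma odd_arithmetic_geometric_sum:
  fixes w :: complex
  shows "(1 - w\<^sup>2)\<^sup>2 * (\<Sum>k<h. (2 * of_nat k + 1) * w ^ (2 * k + 1))
    = w + w ^ 3 - (2 * of_nat h + 1) * w ^ (2 * h + 1) + (2 * of_nat h - 1) * w ^ (2 * h + 3)"
proof (induction h)
  case (Suc h)
  define v where "v = w ^ (2 * h + 1)"
  have v: "w ^ (2 * h + 3) = v * (w * w)" "w ^ (2 * Suc h + 1) = v * (w * w)"
          "w ^ (2 * Suc h + 3) = v * (w * w * w * w)"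
    by (simp_all add: v_def power_add power3_eq_cube eval_nat_numeral)
  show ?case
    unfolding sum.lessThan_Suc distrib_left Suc.IH v v_def[symmetric]
    by (simp add: algebra_simps power2_eq_square)
qed (simp add: algebra_simps power3_eq_cube)

lemma odd_geometric_sum:
  fixes w :: complex
  shows "(1 - w\<^sup>2) * (\<Sum>k<h. w ^ (2 * k + 1)) = w - w ^ (2 * h + 1)"
proof (induction h)
  case (Suc h)
  show ?case
    unfolding sum.lessThan_Suc distrib_left Suc.IH by (simp add: algebra_simps power2_eq_square)
qed simp

text \<open>
  With \<open>w = cis \<theta>\<close> the sum is an arithmetic-geometric sum in \<open>w\<close>. It is evaluated with \<open>w^(2h) = -1\<close>
  and rewritten through \<open>1 - w\<^sup>2 = -2\<i> (sin \<theta>) w\<close> and \<open>1 + w\<^sup>2 = 2 (cos \<theta>) w\<close>.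
\<close>

lemma sawtooth_transform:
  assumes h: "h > 0" and l: "l < h"
  defines "\<theta> \<equiv> of_nat (2 * l + 1) * (pi / of_nat (2 * h))"
  shows "(\<Sum>k<h. (2 * of_nat k + 1 - of_nat h) * ecis (of_nat ((2 * l + 1) * (2 * k + 1)) / of_nat (4 * h)))
           = of_real (- cos \<theta> / (sin \<theta>)\<^sup>2)"
proof -
  define w where "w = cis \<theta>"
  have "\<theta> > 0"
    using h unfolding \<theta>_def by (intro mult_pos_pos divide_pos_pos) auto
  moreover have "\<theta> < of_nat (2 * h) * (pi / of_nat (2 * h))"
    using h l unfolding \<theta>_def by (intro mult_strict_right_mono divide_pos_pos) auto
  hence "\<theta> < pi"
    using h by simp
  ultimately have s: "sin \<theta> > 0"
    by (rule sin_gt_zero)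
  have w_power: "ecis (of_nat ((2 * l + 1) * (2 * k + 1)) / of_nat (4 * h)) = w ^ (2 * k + 1)" for k
  proof -
    have "2 * pi * (a * b / (2 * c)) = b * (a * (pi / c))" for a b c :: real
      by simp
    from this[of "of_nat (2 * l + 1)" "of_nat (2 * k + 1)" "of_nat (2 * h)"]
    have "2 * pi * (of_nat ((2 * l + 1) * (2 * k + 1)) / of_nat (4 * h)) = of_nat (2 * k + 1) * \<theta>"
      unfolding \<theta>_def of_nat_mult by simp
    thus ?thesis
      unfolding w_def Complex.DeMoivre ecis_eq_cis by (rule arg_cong)
  qed
  have w2h: "w ^ (2 * h) = - 1"
  proof -
    have "w ^ (2 * h) = cis (2 * pi * (of_int (2 * int l + 1) / 2))"
      unfolding w_def Complex.DeMoivre \<theta>_def using h by (intro arg_cong[of _ _ cis]) simp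
    thus ?thesis
      using ecis_half_odd[of "2 * int l + 1"] by (simp add: ecis_eq_cis)
  qed
  have w_ne: "w \<noteq> 0"
    by (simp add: w_def)
  have w_diff: "1 - w\<^sup>2 = - 2 * \<i> * of_real (sin \<theta>) * w"
    and w_add: "1 + w\<^sup>2 = 2 * of_real (cos \<theta>) * w"
    using sin_cos_squared_add[of \<theta>]
    by (auto simp: w_def cis.ctr complex_eq_iff power2_eq_square algebra_simps)
  define S where "S = (\<Sum>k<h. (2 * of_nat k + 1 - of_nat h) * w ^ (2 * k + 1))"
  have "(1 - w\<^sup>2)\<^sup>2 * S = (1 - w\<^sup>2)\<^sup>2 * (\<Sum>k<h. (2 * of_nat k + 1) * w ^ (2 * k + 1))
      - of_nat h * (1 - w\<^sup>2) * ((1 - w\<^sup>2) * (\<Sum>k<h. w ^ (2 * k + 1)))"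
  proof -
    have "S = (\<Sum>k<h. (2 * of_nat k + 1) * w ^ (2 * k + 1)) - of_nat h * (\<Sum>k<h. w ^ (2 * k + 1))"
      unfolding S_def left_diff_distrib sum_subtractf sum_distrib_left ..
    moreover have "q\<^sup>2 * (A - c * B) = q\<^sup>2 * A - c * q * (q * B)" for q A B c :: complex
      by (simp add: power2_eq_square algebra_simps)
    ultimately show ?thesis
      by (simp only:)
  qed
  also have "\<dots> = 2 * w * (1 + w\<^sup>2)"
    unfolding odd_arithmetic_geometric_sum odd_geometric_sum unfolding power_add w2h
    by (simp add: algebra_simps power2_eq_square power3_eq_cube)
  finally have "- 4 * (of_real (sin \<theta>))\<^sup>2 * w\<^sup>2 * S = 4 * of_real (cos \<theta>) * w\<^sup>2"
    unfolding w_diff w_add by (simp add: power2_eq_square algebra_simps)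
  hence "(- 4 * w\<^sup>2) * ((of_real (sin \<theta>))\<^sup>2 * S) = (- 4 * w\<^sup>2) * (- of_real (cos \<theta>))"
    by (simp add: mult_ac)
  moreover have "- 4 * w\<^sup>2 \<noteq> 0"
    using w_ne by simp
  ultimately have "(of_real (sin \<theta>))\<^sup>2 * S = - of_real (cos \<theta>)"
    by (simp only: mult_cancel_left) simp
  hence "S = of_real (- cos \<theta> / (sin \<theta>)\<^sup>2)"
    using s by (simp add: field_simps)
  thus ?thesis
    unfolding S_def w_power .
qed

text \<open>
  A telescoping majorant, suggested by \<open>(- 1 / sin \<theta>)' = cos \<theta> / sin\<^sup>2 \<theta>\<close>: a symmetric difference
  quotient, with \<open>sin \<delta>\<close> for \<open>\<delta>\<close>, replaces the derivative, and its error has the right sign because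
  \<open>sin(\<theta> - \<delta>) sin(\<theta> + \<delta>) = sin\<^sup>2 \<theta> - sin\<^sup>2 \<delta>\<close>.
\<close>

lemma cos_over_sin_squared_le:
  assumes "\<delta> > 0" "\<delta> < \<theta>" "\<theta> + \<delta> \<le> pi / 2"
  shows "cos \<theta> / (sin \<theta>)\<^sup>2 \<le> (1 / sin (\<theta> - \<delta>) - 1 / sin (\<theta> + \<delta>)) / (2 * sin \<delta>)"
proof -
  have pos: "sin (\<theta> - \<delta>) > 0" "sin (\<theta> + \<delta>) > 0" "sin \<delta> > 0" "sin \<theta> > 0" "cos \<theta> \<ge> 0"
    using assms pi_gt_zero by (auto intro!: sin_gt_zero cos_ge_zero)
  have prod: "sin (\<theta> - \<delta>) * sin (\<theta> + \<delta>) = (sin \<theta>)\<^sup>2 - (sin \<delta>)\<^sup>2"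
  proof -
    have "sin (\<theta> - \<delta>) * sin (\<theta> + \<delta>) = (sin \<theta>)\<^sup>2 * (cos \<delta>)\<^sup>2 - (cos \<theta>)\<^sup>2 * (sin \<delta>)\<^sup>2"
      by (simp add: sin_add sin_diff power2_eq_square algebra_simps)
    thus ?thesis
      by (simp add: cos_squared_eq algebra_simps)
  qed
  have "1 / sin (\<theta> - \<delta>) - 1 / sin (\<theta> + \<delta>)
      = (sin (\<theta> + \<delta>) - sin (\<theta> - \<delta>)) / (sin (\<theta> - \<delta>) * sin (\<theta> + \<delta>))"
    using pos by (simp add: field_simps)
  also have "sin (\<theta> + \<delta>) - sin (\<theta> - \<delta>) = 2 * sin \<delta> * cos \<theta>"
    by (simp add: sin_add sin_diff)
  finally have "(1 / sin (\<theta> - \<delta>) - 1 / sin (\<theta> + \<delta>)) / (2 * sin \<delta>)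
      = cos \<theta> / (sin (\<theta> - \<delta>) * sin (\<theta> + \<delta>))"
    using pos by simp
  moreover have "cos \<theta> / (sin \<theta>)\<^sup>2 \<le> cos \<theta> / (sin (\<theta> - \<delta>) * sin (\<theta> + \<delta>))"
    using pos by (intro divide_left_mono mult_pos_pos) (auto simp: prod)
  ultimately show ?thesis
    by simp
qed

lemma half_sum_cos_over_sin_squared_le:
  assumes m: "m > 0"
  defines "\<delta> \<equiv> pi / of_nat (4 * m)"
  shows "(\<Sum>l\<in>{1..<m}. cos (of_nat (2 * l + 1) * \<delta>) / (sin (of_nat (2 * l + 1) * \<delta>))\<^sup>2)
           < 1 / (2 * sin \<delta> * sin (2 * \<delta>))"
proof -
  define v where "v = (\<lambda>l. 1 / sin (of_nat (2 * l) * \<delta>))"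
  have \<delta>: "\<delta> > 0"
    using m by (simp add: \<delta>_def)
  have bound: "of_nat (2 * l) * \<delta> \<le> pi / 2" if "l \<le> m" for l
  proof -
    have "of_nat (2 * l) * \<delta> \<le> of_nat (2 * m) * \<delta>"
      using that \<delta> by (intro mult_right_mono) auto
    also have "\<dots> = pi / 2"
      using m by (simp add: \<delta>_def)
    finally show ?thesis .
  qed
  have sin_pos: "sin (of_nat (2 * l) * \<delta>) > 0" if "l \<ge> 1" "l \<le> m" for l
  proof (rule sin_gt_zero)
    show "of_nat (2 * l) * \<delta> > 0"
      using that \<delta> by simp
    show "of_nat (2 * l) * \<delta> < pi"
      using bound[OF that(2)] pi_gt_zero by linarith
  qed
  have "sin \<delta> > 0"
    using bound[of 1] m \<delta> pi_gt_zero by (intro sin_gt_zero) auto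
  have "(\<Sum>l\<in>{1..<m}. cos (of_nat (2 * l + 1) * \<delta>) / (sin (of_nat (2 * l + 1) * \<delta>))\<^sup>2)
      \<le> (\<Sum>l\<in>{1..<m}. (v l - v (Suc l)) / (2 * sin \<delta>))"
  proof (rule sum_mono)
    fix l assume l: "l \<in> {1..<m}"
    have eq: "of_nat (2 * l) * \<delta> = of_nat (2 * l + 1) * \<delta> - \<delta>"
             "of_nat (2 * Suc l) * \<delta> = of_nat (2 * l + 1) * \<delta> + \<delta>"
      by (simp_all add: algebra_simps)
    show "cos (of_nat (2 * l + 1) * \<delta>) / (sin (of_nat (2 * l + 1) * \<delta>))\<^sup>2 \<le> (v l - v (Suc l)) / (2 * sin \<delta>)"
      unfolding v_def eq
    proof (rule cos_over_sin_squared_le[OF \<delta>])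
      show "\<delta> < of_nat (2 * l + 1) * \<delta>"
        using l \<delta> by simp
      show "of_nat (2 * l + 1) * \<delta> + \<delta> \<le> pi / 2"
        using bound[of "Suc l"] l unfolding eq by simp
    qed
  qed
  also have "\<dots> = (v 1 - v m) / (2 * sin \<delta>)"
    using m sum_Suc_diff'[of 1 m "\<lambda>l. - v l"] by (simp add: sum_divide_distrib[symmetric])
  also have "\<dots> < v 1 / (2 * sin \<delta>)"
    using sin_pos[of m] m \<open>sin \<delta> > 0\<close> by (intro divide_strict_right_mono) (auto simp: v_def)
  finally show ?thesis
    by (simp add: v_def mult_ac)
qed

text \<open>
  By Fourier inversion, \<open>-2h L(-1, b)\<close> is the sum over \<open>l < h\<close> of the Gauss sums times
  \<open>g l = cos \<theta>\<^sub>l / sin\<^sup>2 \<theta>\<^sub>l\<close>, where \<open>\<theta>\<^sub>l = (2l + 1) \<delta>\<close> and \<open>\<delta> = \<pi>/(2h)\<close>. The terms \<open>l = 0\<close> and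
  \<open>l = h - 1\<close> coincide, because both factors change sign. All Gauss sums have the same absolute
  value, so vanishing would force \<open>2 \<bar>g 0\<bar>\<close> to be at most the sum of the other \<open>\<bar>g l\<bar>\<close>. The
  telescoping bound makes that sum smaller than \<open>1 / (2 sin\<^sup>2 \<delta> cos \<delta>)\<close>, whence \<open>4 cos\<^sup>2 \<delta> < 1\<close>, which
  is false for \<open>\<delta> \<le> \<pi>/4\<close>.
\<close>

lemma theta_value_1_nonzero:
  assumes h: "h > 0" "even h" and u: "coprime u (int h)"
  shows "theta_value 1 h u \<noteq> 0"
proof
  assume zero: "theta_value 1 h u = 0"
  obtain m where m: "h = 2 * m" using h(2) by (rule evenE)
  have m_pos: "m > 0" using h m by simp
  have "odd u"
    using h(2) u by (rule odd_of_coprime_even)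
  define \<delta> where "\<delta> = pi / of_nat (2 * h)"
  define g where "g = (\<lambda>l. cos (of_nat (2 * l + 1) * \<delta>) / (sin (of_nat (2 * l + 1) * \<delta>))\<^sup>2)"
  have g_reflect: "g (h - Suc l) = - g l" if "l < h" for l
  proof -
    have "of_nat (2 * (h - Suc l) + 1) * \<delta> = pi - of_nat (2 * l + 1) * \<delta>"
      using that by (simp add: \<delta>_def of_nat_diff field_simps)
    thus ?thesis
      by (simp add: g_def del: of_nat_Suc of_nat_add of_nat_mult)
  qed
  have "of_nat h * (2 * theta_value 1 h u)
      = (\<Sum>k<h. (2 * of_nat k + 1 - of_nat h) *
          (\<Sum>l<h. gauss_sum h u l * ecis (of_nat ((2 * l + 1) * (2 * k + 1)) / of_nat (4 * h))))"
    unfolding theta_value_1[OF h(1)] sum_distrib_left[of "of_nat h"]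
    by (intro sum.cong refl, subst theta_coeff_gauss_inversion[OF h(1)]) auto
  also have "\<dots> = (\<Sum>l<h. gauss_sum h u l * (\<Sum>k<h. (2 * of_nat k + 1 - of_nat h) *
          ecis (of_nat ((2 * l + 1) * (2 * k + 1)) / of_nat (4 * h))))"
    unfolding sum_distrib_left by (subst sum.swap) (simp only: mult_ac)
  also have "\<dots> = (\<Sum>l<h. gauss_sum h u l * of_real (- g l))"
    by (intro sum.cong refl, subst sawtooth_transform[OF h(1)]) (auto simp: g_def \<delta>_def)
  finally have "(\<Sum>l<h. gauss_sum h u l * of_real (- g l)) = 0"
    using zero by simp
  also have "{..<h} = insert 0 (insert (h - 1) {1..<h - 1})"
    using h(1) by auto
  also have "(\<Sum>l\<in>insert 0 (insert (h - 1) {1..<h - 1}). gauss_sum h u l * of_real (- g l))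
      = gauss_sum h u 0 * of_real (- g 0) + (gauss_sum h u (h - 1) * of_real (- g (h - 1))
        + (\<Sum>l\<in>{1..<h - 1}. gauss_sum h u l * of_real (- g l)))"
    using m m_pos by (subst sum.insert; simp)+
  also have "gauss_sum h u (h - 1) * of_real (- g (h - 1)) = gauss_sum h u 0 * of_real (- g 0)"
    using gauss_sum_reflect[OF h \<open>odd u\<close>] g_reflect[of 0] h(1) by simp
  finally have "2 * (gauss_sum h u 0 * of_real (g 0)) = (\<Sum>l\<in>{1..<h - 1}. gauss_sum h u l * of_real (- g l))"
    by (simp add: algebra_simps add_eq_0_iff)
  hence "norm (2 * (gauss_sum h u 0 * of_real (g 0))) \<le> (\<Sum>l\<in>{1..<h - 1}. norm (gauss_sum h u l * of_real (- g l)))"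
    by (simp only: norm_sum)
  hence "sqrt (of_nat h) * (2 * \<bar>g 0\<bar>) \<le> sqrt (of_nat h) * (\<Sum>l\<in>{1..<h - 1}. \<bar>g l\<bar>)"
    by (simp add: norm_mult norm_gauss_sum[OF h u] sum_distrib_left mult_ac)
  hence main: "2 * \<bar>g 0\<bar> \<le> (\<Sum>l\<in>{1..<h - 1}. \<bar>g l\<bar>)"
    using h(1) by simp
  have \<delta>_bounds: "\<delta> > 0" "\<delta> \<le> pi / 4"
    using h(1) m m_pos by (auto simp: \<delta>_def field_simps)
  have g_nonneg: "g l \<ge> 0" if "l < m" for l
  proof -
    have "of_nat (2 * l + 1) * \<delta> \<le> of_nat (2 * m) * \<delta>"
      using that \<delta>_bounds by (intro mult_right_mono) auto
    also have "\<dots> = pi / 2"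
      using m_pos by (simp add: \<delta>_def m)
    finally have "of_nat (2 * l + 1) * \<delta> \<le> pi / 2" .
    moreover have "of_nat (2 * l + 1) * \<delta> \<ge> 0"
      using \<delta>_bounds by (intro mult_nonneg_nonneg) auto
    ultimately have "cos (of_nat (2 * l + 1) * \<delta>) \<ge> 0"
      by (intro cos_ge_zero) auto
    thus ?thesis
      by (simp add: g_def)
  qed
  have "(\<Sum>l\<in>{1..<h - 1}. \<bar>g l\<bar>) = (\<Sum>l\<in>{1..<m}. \<bar>g l\<bar>) + (\<Sum>l\<in>{m..<h - 1}. \<bar>g l\<bar>)"
    using m_pos m by (subst sum.atLeastLessThan_concat) auto
  also have "(\<Sum>l\<in>{m..<h - 1}. \<bar>g l\<bar>) = (\<Sum>l\<in>{1..<m}. \<bar>g l\<bar>)"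
  proof (rule sum.reindex_bij_witness[of _ "\<lambda>l. h - Suc l" "\<lambda>l. h - Suc l"])
    fix l assume l: "l \<in> {m..<h - 1}"
    thus "h - Suc l \<in> {1..<m}" "h - Suc (h - Suc l) = l"
      using m by auto
    show "\<bar>g (h - Suc l)\<bar> = \<bar>g l\<bar>"
      using l by (subst g_reflect) auto
  qed (use m in auto)
  also have "(\<Sum>l\<in>{1..<m}. \<bar>g l\<bar>) = (\<Sum>l\<in>{1..<m}. g l)"
    using g_nonneg by (intro sum.cong) auto
  also have "(\<Sum>l\<in>{1..<m}. g l) < 1 / (2 * sin \<delta> * sin (2 * \<delta>))"
    using half_sum_cos_over_sin_squared_le[OF m_pos] by (simp add: g_def \<delta>_def m)
  finally have less: "(\<Sum>l\<in>{1..<h - 1}. \<bar>g l\<bar>) < 2 * (1 / (2 * sin \<delta> * sin (2 * \<delta>)))"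
    by simp
  have s: "sin \<delta> > 0" and c: "cos \<delta> > 0"
    using \<delta>_bounds pi_gt_zero by (auto intro!: sin_gt_zero cos_gt_zero)
  have "\<bar>g 0\<bar> = cos \<delta> / (sin \<delta>)\<^sup>2"
    using c by (simp add: g_def)
  with main less have "2 * (cos \<delta> / (sin \<delta>)\<^sup>2) < 2 * (1 / (2 * sin \<delta> * (2 * sin \<delta> * cos \<delta>)))"
    by (simp add: sin_double)
  hence "4 * (cos \<delta>)\<^sup>2 < 1"
    using s c by (simp add: field_simps power2_eq_square)
  moreover have "cos (pi / 4) \<le> cos \<delta>"
    using \<delta>_bounds pi_gt_zero by (intro cos_monotone_0_pi_le) auto
  hence "(cos (pi / 4))\<^sup>2 \<le> (cos \<delta>)\<^sup>2"
    by (intro power_mono) (simp_all add: cos_45)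
  hence "1 / 2 \<le> (cos \<delta>)\<^sup>2"
    by (simp add: cos_45 power_divide)
  ultimately show False
    by simp
qed

section \<open>The Galois action\<close>

abbreviation complex_ring :: "complex ring" where
  "complex_ring \<equiv> ring_of_type_algebra"

lemma complex_ring_simps:
  "carrier complex_ring = UNIV" "x \<otimes>\<^bsub>complex_ring\<^esub> y = x * y" "x \<oplus>\<^bsub>complex_ring\<^esub> y = x + y"
  "\<one>\<^bsub>complex_ring\<^esub> = 1" "\<zero>\<^bsub>complex_ring\<^esub> = 0"
  by (simp_all add: ring_of_type_algebra_def)

lemma complex_ring_uminus: "\<ominus>\<^bsub>complex_ring\<^esub> x = - x"
proof -
  interpret field complex_ring
    by (rule field_from_type_algebra)
  show ?thesis
    by (rule minus_equality) (simp_all add: complex_ring_simps)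
qed

lemma complex_ring_inverse: "x \<noteq> 0 \<Longrightarrow> inv\<^bsub>complex_ring\<^esub> x = inverse x"
proof -
  assume "x \<noteq> 0"
  interpret field complex_ring
    by (rule field_from_type_algebra)
  show ?thesis
    by (rule comm_inv_char) (use \<open>x \<noteq> 0\<close> in \<open>simp_all add: complex_ring_simps\<close>)
qed

lemma cyclo_field_one: "1 \<in> cyclo_field h"
  using generate_field.one[of complex_ring] by (simp add: cyclo_field_def complex_ring_simps)

lemma cyclo_field_gen: "ecis (1 / of_nat h) \<in> cyclo_field h"
  unfolding cyclo_field_def by (rule generate_field.incl) simp

lemma cyclo_field_add: "x \<in> cyclo_field h \<Longrightarrow> y \<in> cyclo_field h \<Longrightarrow> x + y \<in> cyclo_field h"
  using generate_field.eng_add[of x complex_ring _ y] by (simp add: cyclo_field_def complex_ring_simps)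

lemma cyclo_field_mult: "x \<in> cyclo_field h \<Longrightarrow> y \<in> cyclo_field h \<Longrightarrow> x * y \<in> cyclo_field h"
  using generate_field.eng_mult[of x complex_ring _ y] by (simp add: cyclo_field_def complex_ring_simps)

lemma cyclo_field_uminus: "x \<in> cyclo_field h \<Longrightarrow> - x \<in> cyclo_field h"
  using generate_field.a_inv[of x complex_ring] by (simp add: cyclo_field_def complex_ring_uminus)

lemma cyclo_field_0: "0 \<in> cyclo_field h"
  using cyclo_field_add[OF cyclo_field_one cyclo_field_uminus[OF cyclo_field_one]] by simp

lemma cyclo_field_inverse: "x \<in> cyclo_field h \<Longrightarrow> inverse x \<in> cyclo_field h"
  using generate_field.m_inv[of x complex_ring] cyclo_field_0
  by (cases "x = 0") (simp_all add: cyclo_field_def complex_ring_simps complex_ring_inverse)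

lemma cyclo_field_divide: "x \<in> cyclo_field h \<Longrightarrow> y \<in> cyclo_field h \<Longrightarrow> x / y \<in> cyclo_field h"
  unfolding divide_inverse by (intro cyclo_field_mult cyclo_field_inverse)

lemma cyclo_field_power: "x \<in> cyclo_field h \<Longrightarrow> x ^ n \<in> cyclo_field h"
  by (induction n) (auto intro: cyclo_field_one cyclo_field_mult)

lemma cyclo_field_powi: "x \<in> cyclo_field h \<Longrightarrow> x powi m \<in> cyclo_field h"
  by (cases m rule: int_cases2)
     (auto simp: power_int_minus intro!: cyclo_field_power cyclo_field_inverse)

lemma cyclo_field_of_nat: "of_nat n \<in> cyclo_field h"
  by (induction n) (auto intro: cyclo_field_0 cyclo_field_one cyclo_field_add)

lemma cyclo_field_of_int: "of_int m \<in> cyclo_field h"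
  by (cases m rule: int_cases2) (auto intro!: cyclo_field_of_nat cyclo_field_uminus)

lemma cyclo_field_Rats: "x \<in> \<rat> \<Longrightarrow> x \<in> cyclo_field h"
  by (elim Rats_cases') (auto intro!: cyclo_field_divide cyclo_field_of_int)

lemma cyclo_field_sum: "(\<And>i. i \<in> A \<Longrightarrow> f i \<in> cyclo_field h) \<Longrightarrow> sum f A \<in> cyclo_field h"
  by (induction A rule: infinite_finite_induct) (auto intro: cyclo_field_0 cyclo_field_add)

context
  fixes h :: nat and \<sigma> :: "complex \<Rightarrow> complex"
  assumes \<sigma>: "\<sigma> \<in> cyclo_aut h"
begin

lemma cyclo_aut_hom: "\<sigma> \<in> ring_hom (complex_ring\<lparr>carrier := cyclo_field h\<rparr>) (complex_ring\<lparr>carrier := cyclo_field h\<rparr>)"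
  using \<sigma> by (simp add: cyclo_aut_def Let_def ring_iso_def)

lemma cyclo_aut_add: "x \<in> cyclo_field h \<Longrightarrow> y \<in> cyclo_field h \<Longrightarrow> \<sigma> (x + y) = \<sigma> x + \<sigma> y"
  using ring_hom_add[OF cyclo_aut_hom, of x y] by (simp add: complex_ring_simps)

lemma cyclo_aut_mult: "x \<in> cyclo_field h \<Longrightarrow> y \<in> cyclo_field h \<Longrightarrow> \<sigma> (x * y) = \<sigma> x * \<sigma> y"
  using ring_hom_mult[OF cyclo_aut_hom, of x y] by (simp add: complex_ring_simps)

lemma cyclo_aut_one: "\<sigma> 1 = 1"
  using ring_hom_one[OF cyclo_aut_hom] by (simp add: complex_ring_simps)

lemma cyclo_aut_0: "\<sigma> 0 = 0"
  using cyclo_aut_add[OF cyclo_field_0 cyclo_field_0] by simp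

lemma cyclo_aut_uminus: "x \<in> cyclo_field h \<Longrightarrow> \<sigma> (- x) = - \<sigma> x"
  using cyclo_aut_add[of x "- x"] cyclo_field_uminus[of x h] cyclo_aut_0 by (simp add: eq_neg_iff_add_eq_0 add.commute)

lemma cyclo_aut_inverse: "x \<in> cyclo_field h \<Longrightarrow> \<sigma> (inverse x) = inverse (\<sigma> x)"
proof (cases "x = 0")
  case False
  assume x: "x \<in> cyclo_field h"
  have "\<sigma> x * \<sigma> (inverse x) = 1"
    using cyclo_aut_mult[OF x cyclo_field_inverse[OF x]] False by (simp add: cyclo_aut_one)
  thus ?thesis
    by (metis inverse_unique)
qed (simp add: cyclo_aut_0)

lemma cyclo_aut_divide: "x \<in> cyclo_field h \<Longrightarrow> y \<in> cyclo_field h \<Longrightarrow> \<sigma> (x / y) = \<sigma> x / \<sigma> y"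
  by (simp add: divide_inverse cyclo_aut_mult cyclo_aut_inverse cyclo_field_inverse)

lemma cyclo_aut_power: "x \<in> cyclo_field h \<Longrightarrow> \<sigma> (x ^ n) = \<sigma> x ^ n"
  by (induction n) (simp_all add: cyclo_aut_one cyclo_aut_mult cyclo_field_power)

lemma cyclo_aut_powi: "x \<in> cyclo_field h \<Longrightarrow> \<sigma> (x powi m) = \<sigma> x powi m"
  by (cases m rule: int_cases2)
     (simp_all add: power_int_minus cyclo_aut_power cyclo_aut_inverse cyclo_field_power)

lemma cyclo_aut_of_nat: "\<sigma> (of_nat n) = of_nat n"
  by (induction n) (simp_all add: cyclo_aut_0 cyclo_aut_one cyclo_aut_add cyclo_field_one cyclo_field_of_nat)

lemma cyclo_aut_of_int: "\<sigma> (of_int m) = of_int m"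
  by (cases m rule: int_cases2) (simp_all add: cyclo_aut_of_nat cyclo_aut_uminus cyclo_field_of_nat)

lemma cyclo_aut_Rats: "x \<in> \<rat> \<Longrightarrow> \<sigma> x = x"
  by (elim Rats_cases') (simp add: cyclo_aut_divide cyclo_aut_of_int cyclo_field_of_int)

lemma cyclo_aut_sum:
  "(\<And>i. i \<in> A \<Longrightarrow> f i \<in> cyclo_field h) \<Longrightarrow> \<sigma> (sum f A) = (\<Sum>i\<in>A. \<sigma> (f i))"
  by (induction A rule: infinite_finite_induct)
     (simp_all add: cyclo_aut_0 cyclo_aut_add cyclo_field_sum)

end

lemma half_euler_poly_rat:
  assumes "y \<in> \<rat>"
  shows "half_euler_poly p y \<in> \<rat>"
proof -
  have "of_real y \<in> (\<rat> :: complex set)"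
    using assms by (elim Rats_cases') simp
  moreover have "(\<Prod>i<j. of_nat p - of_nat i) \<in> (\<rat> :: complex set)" for j
    by (intro Rats_prod Rats_diff Rats_of_nat)
  ultimately show ?thesis
    unfolding half_euler_poly_def by (intro Rats_sum Rats_mult Rats_power euler_coeffs_rat)
qed

lemma theta_coeff_powi: "theta_coeff h u k = ecis (1 / of_nat h) powi (u * tri (int k))"
proof -
  have "ecis (1 / of_nat h) powi m = ecis (of_int m / of_nat h)" for m
  proof (cases m rule: int_cases2)
    case (nonneg n)
    thus ?thesis by (simp add: ecis_power)
  next
    case (nonpos n)
    have "ecis (- x) = inverse (ecis x)" for x
      by (simp add: ecis_eq_cis)
    with nonpos show ?thesis by (simp add: power_int_minus ecis_power)
  qed
  thus ?thesis
    by (simp add: theta_coeff_def)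
qed

text \<open>
  All dependence on \<open>u\<close> sits in the exponents of \<open>\<xi>\<close>; the weights are rational, hence fixed.
\<close>

lemma theta_value_galois:
  shows theta_value_in_cyclo_field: "theta_value p h u \<in> cyclo_field h"
    and cyclo_aut_theta_value: "\<sigma> \<in> cyclo_aut h \<Longrightarrow>
       \<sigma> (ecis (1 / of_nat h)) = ecis (1 / of_nat h) powi v \<Longrightarrow>
       \<sigma> (theta_value p h u) = theta_value p h (v * u)"
proof -
  define c where "c = (\<lambda>j. of_nat (2 * h) ^ p * half_euler_poly p (of_nat (2 * j + 1) / of_nat (2 * h)))"
  have c: "c j \<in> \<rat>" for j
    unfolding c_def by (intro Rats_mult Rats_power Rats_of_nat half_euler_poly_rat Rats_divide)
  have value_eq: "theta_value p h w = (\<Sum>j<h. theta_coeff h w j * c j)" for w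
    by (simp add: theta_value_def c_def sum_distrib_left mult_ac)
  have coeff: "theta_coeff h w j \<in> cyclo_field h" for w j
    unfolding theta_coeff_powi by (intro cyclo_field_powi cyclo_field_gen)
  have mem: "theta_coeff h w j * c j \<in> cyclo_field h" for w j
    by (intro cyclo_field_mult coeff cyclo_field_Rats c)
  show "theta_value p h u \<in> cyclo_field h"
    unfolding value_eq by (intro cyclo_field_sum mem)
  assume \<sigma>: "\<sigma> \<in> cyclo_aut h"
    and v: "\<sigma> (ecis (1 / of_nat h)) = ecis (1 / of_nat h) powi v"
  have "\<sigma> (theta_coeff h u j) = theta_coeff h (v * u) j" for j
    unfolding theta_coeff_powi cyclo_aut_powi[OF \<sigma> cyclo_field_gen] v power_int_mult[symmetric]
    by (simp add: mult.assoc)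
  thus "\<sigma> (theta_value p h u) = theta_value p h (v * u)"
    by (simp add: value_eq cyclo_aut_sum[OF \<sigma> mem] cyclo_aut_mult[OF \<sigma> coeff cyclo_field_Rats[OF c]]
        cyclo_aut_Rats[OF \<sigma> c])
qed

text \<open>
  Numerator and denominator of \<open>W_ratio\<close> converge separately; the limit of the denominator is nonzero.
\<close>

lemma radial_limit:
  assumes h: "h > 0" "even h" and u: "coprime u (int h)"
  shows W_ratio_tendsto:
      "((\<lambda>t::real. W_ratio n (- ecis (of_int u / of_nat h) * of_real (exp (- t))))
         \<longlongrightarrow> theta_value (2 * n + 1) h u / theta_value 1 h u) (at_right 0)"
    and radial_value_eq: "radial_value n (- ecis (of_int u / of_nat h)) =
         theta_value (2 * n + 1) h u / theta_value 1 h u"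
proof -
  have "odd u"
    using h(2) u by (rule odd_of_coprime_even)
  show lim: "((\<lambda>t::real. W_ratio n (- ecis (of_int u / of_nat h) * of_real (exp (- t))))
         \<longlongrightarrow> theta_value (2 * n + 1) h u / theta_value 1 h u) (at_right 0)"
    unfolding W_ratio_def
    using N_series_tendsto[OF h \<open>odd u\<close>, of n] N_series_tendsto[OF h \<open>odd u\<close>, of 0]
      theta_value_1_nonzero[OF h u]
    by (intro tendsto_divide) simp_all
  show "radial_value n (- ecis (of_int u / of_nat h)) =
         theta_value (2 * n + 1) h u / theta_value 1 h u"
    unfolding radial_value_def by (rule tendsto_Lim[OF _ lim]) simp
qed

theorem theorem5p4:
  fixes h n :: nat and u :: int
  assumes "h \<ge> 2" and "even h" and "coprime u (int h)"
  shows "L_b h u (- 2 * of_nat n - 1) \<in> cyclo_field h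
    \<and> A_ratio n h u \<in> cyclo_field h
    \<and> ((\<lambda>t::real. W_ratio n (- ecis (of_int u / of_nat h) * of_real (exp (- t)))) \<longlongrightarrow>
          radial_value n (- ecis (of_int u / of_nat h))) (at_right 0)
    \<and> radial_value n (- ecis (of_int u / of_nat h)) \<in> cyclo_field h
    \<and> (\<forall>v::int. \<forall>\<sigma>\<in>cyclo_aut h.
          coprime v (int h) \<longrightarrow> \<sigma> (ecis (1 / of_nat h)) = ecis (1 / of_nat h) powi v \<longrightarrow>
            \<sigma> (L_b h u (- 2 * of_nat n - 1)) = L_b h (v * u) (- 2 * of_nat n - 1)
          \<and> \<sigma> (A_ratio n h u) = A_ratio n h (v * u)
          \<and> \<sigma> (radial_value n (- ecis (of_int u / of_nat h))) =
              radial_value n (- ecis (of_int (v * u) / of_nat h)))"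
proof -
  define V where "V = (\<lambda>w. theta_value (2 * n + 1) h w)"
  define V1 where "V1 = (\<lambda>w. theta_value 1 h w)"
  have h: "h > 0" "even h"
    using assms by auto
  have L: "L_b h w (- 2 * of_nat n - 1) = V w" and A: "A_ratio n h w = V w / V1 w"
    and R: "radial_value n (- ecis (of_int w / of_nat h)) = V w / V1 w"
    if w: "coprime w (int h)" for w
  proof -
    have "odd w"
      using h(2) w by (rule odd_of_coprime_even)
    have s: "- 2 * of_nat n - 1 = (- of_nat (2 * n + 1) :: complex)"
      by simp
    show L: "L_b h w (- 2 * of_nat n - 1) = V w"
      unfolding s V_def by (rule L_b_neg_nat[OF h \<open>odd w\<close>])
    have "L_b h w (- 1) = V1 w"
      using L_b_neg_nat[OF h \<open>odd w\<close>, of 1] by (simp add: V1_def)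
    with L show "A_ratio n h w = V w / V1 w"
      by (simp only: A_ratio_def)
    show "radial_value n (- ecis (of_int w / of_nat h)) = V w / V1 w"
      unfolding V_def V1_def by (rule radial_value_eq[OF h w])
  qed
  have mem: "V w \<in> cyclo_field h" "V1 w \<in> cyclo_field h" for w
    unfolding V_def V1_def by (rule theta_value_in_cyclo_field)+
  have galois: "\<sigma> (L_b h u (- 2 * of_nat n - 1)) = L_b h (v * u) (- 2 * of_nat n - 1)
      \<and> \<sigma> (A_ratio n h u) = A_ratio n h (v * u)
      \<and> \<sigma> (radial_value n (- ecis (of_int u / of_nat h))) =
          radial_value n (- ecis (of_int (v * u) / of_nat h))"
    if \<sigma>: "\<sigma> \<in> cyclo_aut h" and v: "coprime v (int h)"
      and gen: "\<sigma> (ecis (1 / of_nat h)) = ecis (1 / of_nat h) powi v" for v \<sigma>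
  proof -
    have vu: "coprime (v * u) (int h)"
      using v assms(3) by simp
    have "\<sigma> (V u) = V (v * u)" "\<sigma> (V1 u) = V1 (v * u)"
      unfolding V_def V1_def by (rule cyclo_aut_theta_value[OF \<sigma> gen])+
    thus ?thesis
      unfolding L[OF assms(3)] A[OF assms(3)] R[OF assms(3)] L[OF vu] A[OF vu] R[OF vu]
      by (simp add: cyclo_aut_divide[OF \<sigma> mem])
  qed
  have "((\<lambda>t::real. W_ratio n (- ecis (of_int u / of_nat h) * of_real (exp (- t)))) \<longlongrightarrow>
          radial_value n (- ecis (of_int u / of_nat h))) (at_right 0)"
    unfolding R[OF assms(3)] V_def V1_def by (rule W_ratio_tendsto[OF h assms(3)])
  thus ?thesis
    using L[OF assms(3)] A[OF assms(3)] R[OF assms(3)] mem galois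
    by (simp add: cyclo_field_divide)
qed

end
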